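(* Let $\mathcal{A}$ be an abelian category, $n\geq 1$, $I=\{1,\dots,n\}$, let $G=(G_i)_{i\in I}$ be a family of additive covariant endofunctors of $\mathcal{A}$ and let $\Psi=(\Psi_{i,j}:G_{i+j}\to G_iG_j)$ be a coassociative family of natural transformations. If $G_i$ is left exact for every $i\in I$, then the left $n$-trivial extension $G\rtimes_n\mathcal{A}$ is an abelian category.
   Context: The family $\Psi$ consists of natural transformations $\Psi_{i,j}:G_{i+j}\to G_iG_j$, one for each $i,j\in I$ with $i+j\in I$. It is coassociative if for all $i,j,k\in I$ with $i+j+k\in I$ and every object $X$ of $\mathcal{A}$: $G_i((\Psi_{j,k})_X)\circ(\Psi_{i,j+k})_X=(\Psi_{i,j})_{G_kX}\circ(\Psi_{i+j,k})_X$. The left $n$-trivial extension $G\rtimes_n\mathcal{A}$ (with respect to $\Psi$) is the following category. Objects are pairs $(X,g)$ with $X$ an object of $\mathcal{A}$ and $g=(g_i)_{i\in I}$ a family of morphisms $g_i:X\to G_iX$ such that for all $i,j\in I$: $G_i(g_j)\circ g_i=(\Psi_{i,j})_X\circ g_{i+j}$ if $i+j\leq n$, and $G_i(g_j)\circ g_i=0$ if $i+j>n$. A morphism $(X,\alpha)\to(Y,\beta)$ is a morphism $\gamma:X\to Y$ in $\mathcal{A}$ with $\beta_i\circ\gamma=G_i(\gamma)\circ\alpha_i$ for all $i\in I$. *)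

theory Defs
  imports "HOL-Algebra.Group"
begin

section \<open>Preadditive and abelian categories\<close>

text \<open>Only the values of the operations on (composable, parallel) arrows matter;
  \<open>Comp C g f\<close> is the composite \<open>g \<circ> f\<close>, and \<open>Zero C X Y\<close> is the zero
  morphism \<open>X \<rightarrow> Y\<close>.\<close>

record ('o, 'm) cat =
  Obj :: "'o set"
  Arr :: "'m set"
  Dom :: "'m \<Rightarrow> 'o"
  Cod :: "'m \<Rightarrow> 'o"
  Idt :: "'o \<Rightarrow> 'm"
  Comp :: "'m \<Rightarrow> 'm \<Rightarrow> 'm"  (infixl "\<cdot>\<index>" 70)

record ('o, 'm) preadditive_cat = "('o, 'm) cat" +
  Add :: "'m \<Rightarrow> 'm \<Rightarrow> 'm"
  Zero :: "'o \<Rightarrow> 'o \<Rightarrow> 'm"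

definition Hom :: "('o, 'm, 'z) cat_scheme \<Rightarrow> 'o \<Rightarrow> 'o \<Rightarrow> 'm set" where
  "Hom C X Y = {f \<in> Arr C. Dom C f = X \<and> Cod C f = Y}"

locale category =
  fixes C :: "('o, 'm, 'z) cat_scheme" (structure)
  assumes Dom_closed: "f \<in> Arr C \<Longrightarrow> Dom C f \<in> Obj C"
    and Cod_closed: "f \<in> Arr C \<Longrightarrow> Cod C f \<in> Obj C"
    and Idt_closed: "X \<in> Obj C \<Longrightarrow> Idt C X \<in> Hom C X X"
    and Comp_closed: "\<lbrakk>f \<in> Hom C X Y; g \<in> Hom C Y Z\<rbrakk> \<Longrightarrow> g \<cdot> f \<in> Hom C X Z"
    and Comp_assoc: "\<lbrakk>f \<in> Hom C W X; g \<in> Hom C X Y; h \<in> Hom C Y Z\<rbrakk>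
      \<Longrightarrow> (h \<cdot> g) \<cdot> f = h \<cdot> (g \<cdot> f)"
    and Comp_Idt_right: "f \<in> Hom C X Y \<Longrightarrow> f \<cdot> Idt C X = f"
    and Comp_Idt_left: "f \<in> Hom C X Y \<Longrightarrow> Idt C Y \<cdot> f = f"

definition Hom_group :: "('o, 'm, 'z) preadditive_cat_scheme \<Rightarrow> 'o \<Rightarrow> 'o \<Rightarrow> 'm monoid" where
  "Hom_group C X Y = \<lparr>carrier = Hom C X Y, mult = Add C, one = Zero C X Y\<rparr>"

locale preadditive_category = category C
  for C :: "('o, 'm, 'z) preadditive_cat_scheme" (structure) +
  assumes Hom_comm_group: "\<lbrakk>X \<in> Obj C; Y \<in> Obj C\<rbrakk> \<Longrightarrow> comm_group (Hom_group C X Y)"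
    and Comp_Add_right: "\<lbrakk>f \<in> Hom C X Y; f' \<in> Hom C X Y; g \<in> Hom C Y Z\<rbrakk>
      \<Longrightarrow> g \<cdot> Add C f f' = Add C (g \<cdot> f) (g \<cdot> f')"
    and Comp_Add_left: "\<lbrakk>f \<in> Hom C X Y; g \<in> Hom C Y Z; g' \<in> Hom C Y Z\<rbrakk>
      \<Longrightarrow> Add C g g' \<cdot> f = Add C (g \<cdot> f) (g' \<cdot> f)"

definition monomorphism :: "('o, 'm, 'z) cat_scheme \<Rightarrow> 'm \<Rightarrow> bool" where
  "monomorphism C f \<longleftrightarrow> f \<in> Arr C \<and>
    (\<forall>W. \<forall>u \<in> Hom C W (Dom C f). \<forall>v \<in> Hom C W (Dom C f). f \<cdot>\<^bsub>C\<^esub> u = f \<cdot>\<^bsub>C\<^esub> v \<longrightarrow> u = v)"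

definition epimorphism :: "('o, 'm, 'z) cat_scheme \<Rightarrow> 'm \<Rightarrow> bool" where
  "epimorphism C f \<longleftrightarrow> f \<in> Arr C \<and>
    (\<forall>W. \<forall>u \<in> Hom C (Cod C f) W. \<forall>v \<in> Hom C (Cod C f) W. u \<cdot>\<^bsub>C\<^esub> f = v \<cdot>\<^bsub>C\<^esub> f \<longrightarrow> u = v)"

definition zero_object :: "('o, 'm, 'z) cat_scheme \<Rightarrow> 'o \<Rightarrow> bool" where
  "zero_object C Z \<longleftrightarrow> Z \<in> Obj C \<and>
    (\<forall>X \<in> Obj C. (\<exists>!f. f \<in> Hom C X Z) \<and> (\<exists>!f. f \<in> Hom C Z X))"

definition is_biproduct ::
  "('o, 'm, 'z) preadditive_cat_scheme \<Rightarrow> 'o \<Rightarrow> 'o \<Rightarrow> 'o \<Rightarrow> 'm \<Rightarrow> 'm \<Rightarrow> 'm \<Rightarrow> 'm \<Rightarrow> bool" where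
  "is_biproduct C X Y P p q i j \<longleftrightarrow>
    p \<in> Hom C P X \<and> q \<in> Hom C P Y \<and> i \<in> Hom C X P \<and> j \<in> Hom C Y P \<and>
    p \<cdot>\<^bsub>C\<^esub> i = Idt C X \<and> q \<cdot>\<^bsub>C\<^esub> j = Idt C Y \<and>
    p \<cdot>\<^bsub>C\<^esub> j = Zero C Y X \<and> q \<cdot>\<^bsub>C\<^esub> i = Zero C X Y \<and>
    Add C (i \<cdot>\<^bsub>C\<^esub> p) (j \<cdot>\<^bsub>C\<^esub> q) = Idt C P"

definition is_kernel :: "('o, 'm, 'z) preadditive_cat_scheme \<Rightarrow> 'm \<Rightarrow> 'm \<Rightarrow> bool" where
  "is_kernel C k f \<longleftrightarrow> f \<in> Arr C \<and> k \<in> Arr C \<and> Cod C k = Dom C f \<and>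
    f \<cdot>\<^bsub>C\<^esub> k = Zero C (Dom C k) (Cod C f) \<and>
    (\<forall>W. \<forall>h \<in> Hom C W (Dom C f). f \<cdot>\<^bsub>C\<^esub> h = Zero C W (Cod C f) \<longrightarrow>
      (\<exists>!u. u \<in> Hom C W (Dom C k) \<and> k \<cdot>\<^bsub>C\<^esub> u = h))"

definition is_cokernel :: "('o, 'm, 'z) preadditive_cat_scheme \<Rightarrow> 'm \<Rightarrow> 'm \<Rightarrow> bool" where
  "is_cokernel C c f \<longleftrightarrow> f \<in> Arr C \<and> c \<in> Arr C \<and> Dom C c = Cod C f \<and>
    c \<cdot>\<^bsub>C\<^esub> f = Zero C (Dom C f) (Cod C c) \<and>
    (\<forall>W. \<forall>h \<in> Hom C (Cod C f) W. h \<cdot>\<^bsub>C\<^esub> f = Zero C (Dom C f) W \<longrightarrow>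
      (\<exists>!u. u \<in> Hom C (Cod C c) W \<and> u \<cdot>\<^bsub>C\<^esub> c = h))"

locale abelian_category = preadditive_category C
  for C :: "('o, 'm, 'z) preadditive_cat_scheme" (structure) +
  assumes has_zero_object: "\<exists>Z. zero_object C Z"
    and has_biproducts: "\<lbrakk>X \<in> Obj C; Y \<in> Obj C\<rbrakk> \<Longrightarrow> \<exists>P p q i j. is_biproduct C X Y P p q i j"
    and has_kernels: "f \<in> Arr C \<Longrightarrow> \<exists>k. is_kernel C k f"
    and has_cokernels: "f \<in> Arr C \<Longrightarrow> \<exists>c. is_cokernel C c f"
    and mono_is_kernel: "monomorphism C m \<Longrightarrow> \<exists>f. is_kernel C m f"
    and epi_is_cokernel: "epimorphism C e \<Longrightarrow> \<exists>f. is_cokernel C e f"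


section \<open>Functors, exactness and natural transformations\<close>

record ('o, 'm, 'p, 'k) func =
  FObj :: "'o \<Rightarrow> 'p"
  FArr :: "'m \<Rightarrow> 'k"

definition func_comp ::
  "('p, 'k, 'q, 'l) func \<Rightarrow> ('o, 'm, 'p, 'k) func \<Rightarrow> ('o, 'm, 'q, 'l) func" where
  "func_comp F G = \<lparr>FObj = (\<lambda>X. FObj F (FObj G X)), FArr = (\<lambda>f. FArr F (FArr G f))\<rparr>"

locale covariant_functor = source: category C + target: category D
  for C :: "('o, 'm, 'z) cat_scheme" and D :: "('p, 'k, 'y) cat_scheme" +
  fixes F :: "('o, 'm, 'p, 'k) func"
  assumes FObj_closed: "X \<in> Obj C \<Longrightarrow> FObj F X \<in> Obj D"
    and FArr_closed: "f \<in> Hom C X Y \<Longrightarrow> FArr F f \<in> Hom D (FObj F X) (FObj F Y)"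
    and FArr_Idt: "X \<in> Obj C \<Longrightarrow> FArr F (Idt C X) = Idt D (FObj F X)"
    and FArr_Comp: "\<lbrakk>f \<in> Hom C X Y; g \<in> Hom C Y Z\<rbrakk>
      \<Longrightarrow> FArr F (g \<cdot>\<^bsub>C\<^esub> f) = FArr F g \<cdot>\<^bsub>D\<^esub> FArr F f"

locale additive_functor =
  source: preadditive_category C + target: preadditive_category D + covariant_functor C D F
  for C :: "('o, 'm, 'z) preadditive_cat_scheme"
    and D :: "('p, 'k, 'y) preadditive_cat_scheme"
    and F :: "('o, 'm, 'p, 'k) func" +
  assumes FArr_Add: "\<lbrakk>f \<in> Hom C X Y; g \<in> Hom C X Y\<rbrakk>
      \<Longrightarrow> FArr F (Add C f g) = Add D (FArr F f) (FArr F g)"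

definition is_image :: "('o, 'm, 'z) preadditive_cat_scheme \<Rightarrow> 'm \<Rightarrow> 'm \<Rightarrow> bool" where
  "is_image C m f \<longleftrightarrow> (\<exists>c. is_cokernel C c f \<and> is_kernel C m c)"

definition exact_pair :: "('o, 'm, 'z) preadditive_cat_scheme \<Rightarrow> 'm \<Rightarrow> 'm \<Rightarrow> bool" where
  "exact_pair C f g \<longleftrightarrow> (\<exists>m. is_image C m f \<and> is_kernel C m g)"

text \<open>Exactness of \<open>0 \<rightarrow> X \<rightarrow> Y \<rightarrow> Z\<close> with maps \<open>f : X \<rightarrow> Y\<close> and \<open>g : Y \<rightarrow> Z\<close>.\<close>

definition left_exact_sequence :: "('o, 'm, 'z) preadditive_cat_scheme \<Rightarrow> 'm \<Rightarrow> 'm \<Rightarrow> bool" where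
  "left_exact_sequence C f g \<longleftrightarrow>
    (\<exists>Z. zero_object C Z \<and> exact_pair C (Zero C Z (Dom C f)) f) \<and> exact_pair C f g"

definition left_exact ::
  "('o, 'm, 'z) preadditive_cat_scheme \<Rightarrow> ('p, 'k, 'y) preadditive_cat_scheme
    \<Rightarrow> ('o, 'm, 'p, 'k) func \<Rightarrow> bool" where
  "left_exact C D F \<longleftrightarrow>
    (\<forall>f g. left_exact_sequence C f g \<longrightarrow> left_exact_sequence D (FArr F f) (FArr F g))"

locale natural_transformation = source: covariant_functor C D F + target: covariant_functor C D G
  for C :: "('o, 'm, 'z) cat_scheme" and D :: "('p, 'k, 'y) cat_scheme"
    and F :: "('o, 'm, 'p, 'k) func" and G :: "('o, 'm, 'p, 'k) func" +
  fixes \<eta> :: "'o \<Rightarrow> 'k"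
  assumes component_closed: "X \<in> Obj C \<Longrightarrow> \<eta> X \<in> Hom D (FObj F X) (FObj G X)"
    and naturality: "f \<in> Hom C X Y \<Longrightarrow> \<eta> Y \<cdot>\<^bsub>D\<^esub> FArr F f = FArr G f \<cdot>\<^bsub>D\<^esub> \<eta> X"


section \<open>The left \<open>n\<close>-trivial extension\<close>

text \<open>The index set \<open>I\<close> is \<open>{1..n}\<close>; \<open>G i\<close> and \<open>\<Psi> i j\<close> are only relevant for
  \<open>i\<close> in \<open>I\<close>, respectively for \<open>i\<close>, \<open>j\<close> and \<open>i + j\<close> in \<open>I\<close>.\<close>

definition natural_family ::
  "('o, 'm, 'z) cat_scheme \<Rightarrow> nat \<Rightarrow> (nat \<Rightarrow> ('o, 'm, 'o, 'm) func)
    \<Rightarrow> (nat \<Rightarrow> nat \<Rightarrow> 'o \<Rightarrow> 'm) \<Rightarrow> bool" where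
  "natural_family A n G \<Psi> \<longleftrightarrow>
    (\<forall>i \<in> {1..n}. \<forall>j \<in> {1..n}. i + j \<in> {1..n} \<longrightarrow>
      natural_transformation A A (G (i + j)) (func_comp (G i) (G j)) (\<Psi> i j))"

definition coassociative ::
  "('o, 'm, 'z) cat_scheme \<Rightarrow> nat \<Rightarrow> (nat \<Rightarrow> ('o, 'm, 'o, 'm) func)
    \<Rightarrow> (nat \<Rightarrow> nat \<Rightarrow> 'o \<Rightarrow> 'm) \<Rightarrow> bool" where
  "coassociative A n G \<Psi> \<longleftrightarrow>
    (\<forall>i \<in> {1..n}. \<forall>j \<in> {1..n}. \<forall>k \<in> {1..n}. i + j + k \<in> {1..n} \<longrightarrow>
      (\<forall>X \<in> Obj A. FArr (G i) (\<Psi> j k X) \<cdot>\<^bsub>A\<^esub> \<Psi> i (j + k) X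
        = \<Psi> i j (FObj (G k) X) \<cdot>\<^bsub>A\<^esub> \<Psi> (i + j) k X))"

text \<open>The families are extensional functions on \<open>I\<close>, so that two objects are equal
  exactly if their components are.\<close>

definition ext_objects ::
  "('o, 'm, 'z) preadditive_cat_scheme \<Rightarrow> nat \<Rightarrow> (nat \<Rightarrow> ('o, 'm, 'o, 'm) func)
    \<Rightarrow> (nat \<Rightarrow> nat \<Rightarrow> 'o \<Rightarrow> 'm) \<Rightarrow> ('o \<times> (nat \<Rightarrow> 'm)) set" where
  "ext_objects A n G \<Psi> =
    {(X, g). X \<in> Obj A \<and> g \<in> (\<Pi>\<^sub>E i \<in> {1..n}. Hom A X (FObj (G i) X)) \<and>
      (\<forall>i \<in> {1..n}. \<forall>j \<in> {1..n}.
        (i + j \<le> n \<longrightarrow> FArr (G i) (g j) \<cdot>\<^bsub>A\<^esub> g i = \<Psi> i j X \<cdot>\<^bsub>A\<^esub> g (i + j)) \<and>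
        (i + j > n \<longrightarrow> FArr (G i) (g j) \<cdot>\<^bsub>A\<^esub> g i = Zero A X (FObj (G i) (FObj (G j) X))))}"

text \<open>One morphism of \<open>A\<close> may underlie morphisms between several pairs of objects, so an arrow
  is stored together with its source and target, as \<open>(source, \<gamma>, target)\<close>.  Addition of
  parallel arrows is that of \<open>A\<close>.\<close>

definition ext_arrows ::
  "('o, 'm, 'z) preadditive_cat_scheme \<Rightarrow> nat \<Rightarrow> (nat \<Rightarrow> ('o, 'm, 'o, 'm) func)
    \<Rightarrow> (nat \<Rightarrow> nat \<Rightarrow> 'o \<Rightarrow> 'm)
    \<Rightarrow> (('o \<times> (nat \<Rightarrow> 'm)) \<times> 'm \<times> ('o \<times> (nat \<Rightarrow> 'm))) set" where
  "ext_arrows A n G \<Psi> =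
    {((X, \<alpha>), \<gamma>, (Y, \<beta>)) | X \<alpha> \<gamma> Y \<beta>.
      (X, \<alpha>) \<in> ext_objects A n G \<Psi> \<and> (Y, \<beta>) \<in> ext_objects A n G \<Psi> \<and> \<gamma> \<in> Hom A X Y \<and>
      (\<forall>i \<in> {1..n}. \<beta> i \<cdot>\<^bsub>A\<^esub> \<gamma> = FArr (G i) \<gamma> \<cdot>\<^bsub>A\<^esub> \<alpha> i)}"

definition left_trivial_extension ::
  "('o, 'm, 'z) preadditive_cat_scheme \<Rightarrow> nat \<Rightarrow> (nat \<Rightarrow> ('o, 'm, 'o, 'm) func)
    \<Rightarrow> (nat \<Rightarrow> nat \<Rightarrow> 'o \<Rightarrow> 'm)
    \<Rightarrow> ('o \<times> (nat \<Rightarrow> 'm), ('o \<times> (nat \<Rightarrow> 'm)) \<times> 'm \<times> ('o \<times> (nat \<Rightarrow> 'm))) preadditive_cat" where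
  "left_trivial_extension A n G \<Psi> =
    \<lparr>Obj = ext_objects A n G \<Psi>,
     Arr = ext_arrows A n G \<Psi>,
     Dom = (\<lambda>(P, \<gamma>, Q). P),
     Cod = (\<lambda>(P, \<gamma>, Q). Q),
     Idt = (\<lambda>P. (P, Idt A (fst P), P)),
     Comp = (\<lambda>(Q, \<delta>, R) (P, \<gamma>, Q'). (P, \<delta> \<cdot>\<^bsub>A\<^esub> \<gamma>, R)),
     Add = (\<lambda>(P, \<gamma>, Q) (P', \<delta>, Q'). (P, Add A \<gamma> \<delta>, Q)),
     Zero = (\<lambda>P Q. (P, Zero A (fst P) (fst Q), Q))\<rparr>"

end

theory Submission
  imports Defs
begin

text \<open>Limits and colimits in the extension are those of \<open>A\<close>.  A cokernel inherits its family
  from its universal property, with no hypothesis on the functors, whereas a kernel \<open>k\<close> needs every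
  \<open>G i\<close> to preserve it, so that the restricted family factors through \<open>G i k\<close>.  Consequently the
  forgetful functor to \<open>A\<close> preserves monomorphisms and epimorphisms, and a monomorphism (an
  epimorphism) of the extension is the kernel of its cokernel (the cokernel of its kernel) because
  this holds in \<open>A\<close>.\<close>

section \<open>Preadditive and abelian categories\<close>

text \<open>Left exactness is stated through exact sequences, with an image being a kernel of a
  cokernel, so preservation of kernels has to be extracted from it. Both halves of this translation
  rest on the fact that a monomorphism of an abelian category is the kernel of its own cokernel. The
  structure identity is quadratic in the family, so a constructed family is never tested directly;
  its identity is compared with that of a given object. Over a kernel \<open>k\<close> this requires
  cancelling \<open>FArr (G i) (FArr (G j) k)\<close> on the left, so kernels must survive two
  functors in succession. Over a cokernel, or over the two injections of a biproduct, the arrows of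
  \<open>A\<close> themselves are cancelled on the right. Reflecting monomorphisms to
  \<open>A\<close> is not formal, since an arrow of the extension is cancellable only against arrows
  of the extension. Lifting the kernel of the underlying arrow turns it into an admissible test
  arrow, and comparison with the zero arrow forces it to vanish. Epimorphisms are treated
  dually.\<close>

context category
begin

lemma Hom_Obj:
  assumes "f \<in> Hom C X Y"
  shows "X \<in> Obj C" "Y \<in> Obj C"
  using assms Dom_closed Cod_closed by (auto simp: Hom_def)

lemma Arr_Hom: "f \<in> Arr C \<Longrightarrow> f \<in> Hom C (Dom C f) (Cod C f)"
  by (simp add: Hom_def)

lemma monomorphismI:
  assumes "m \<in> Hom C X Y"
    and "\<And>W u v. \<lbrakk>u \<in> Hom C W X; v \<in> Hom C W X; m \<cdot> u = m \<cdot> v\<rbrakk> \<Longrightarrow> u = v"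
  shows "monomorphism C m"
  using assms by (auto simp: monomorphism_def Hom_def)

lemma monomorphismD:
  assumes "monomorphism C m" "m \<in> Hom C X Y" "u \<in> Hom C W X" "v \<in> Hom C W X" "m \<cdot> u = m \<cdot> v"
  shows "u = v"
  using assms by (auto simp: monomorphism_def Hom_def)

lemma epimorphismI:
  assumes "e \<in> Hom C X Y"
    and "\<And>W u v. \<lbrakk>u \<in> Hom C Y W; v \<in> Hom C Y W; u \<cdot> e = v \<cdot> e\<rbrakk> \<Longrightarrow> u = v"
  shows "epimorphism C e"
  using assms by (auto simp: epimorphism_def Hom_def)

lemma epimorphismD:
  assumes "epimorphism C e" "e \<in> Hom C X Y" "u \<in> Hom C Y W" "v \<in> Hom C Y W" "u \<cdot> e = v \<cdot> e"
  shows "u = v"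
  using assms by (auto simp: epimorphism_def Hom_def)

end

section \<open>Hom groups, zero arrows, kernels and cokernels in a preadditive category\<close>

context preadditive_category
begin

lemma Zero_closed: "\<lbrakk>X \<in> Obj C; Y \<in> Obj C\<rbrakk> \<Longrightarrow> Zero C X Y \<in> Hom C X Y"
  using monoid.one_closed[OF group.is_monoid[OF comm_group.axioms(2)[OF Hom_comm_group]]]
  by (simp add: Hom_group_def)

lemma Add_closed: "\<lbrakk>f \<in> Hom C X Y; g \<in> Hom C X Y\<rbrakk> \<Longrightarrow> Add C f g \<in> Hom C X Y"
  using monoid.m_closed[OF group.is_monoid[OF comm_group.axioms(2)[OF Hom_comm_group]], of X Y f g]
    Hom_Obj[of f X Y]
  by (simp add: Hom_group_def)

lemma Add_assoc:
  assumes "f \<in> Hom C X Y" "g \<in> Hom C X Y" "h \<in> Hom C X Y"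
  shows "Add C (Add C f g) h = Add C f (Add C g h)"
  using monoid.m_assoc[OF group.is_monoid[OF comm_group.axioms(2)[OF Hom_comm_group]], of X Y f g h]
    Hom_Obj[of f X Y] assms
  by (simp add: Hom_group_def)

lemma Add_commute:
  assumes "f \<in> Hom C X Y" "g \<in> Hom C X Y"
  shows "Add C f g = Add C g f"
  using comm_monoid.m_comm[OF comm_group.axioms(1)[OF Hom_comm_group], of X Y f g]
    Hom_Obj[of f X Y] assms
  by (simp add: Hom_group_def)

lemma Add_Zero_left: "f \<in> Hom C X Y \<Longrightarrow> Add C (Zero C X Y) f = f"
  using monoid.l_one[OF group.is_monoid[OF comm_group.axioms(2)[OF Hom_comm_group]], of X Y f]
    Hom_Obj[of f X Y]
  by (simp add: Hom_group_def)

lemma Add_Zero_right: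
  assumes "f \<in> Hom C X Y"
  shows "Add C f (Zero C X Y) = f"
  using Add_Zero_left[OF assms] Add_commute[OF assms] Zero_closed Hom_Obj[OF assms] by metis

lemma Add_inverse:
  assumes "f \<in> Hom C X Y"
  obtains g where "g \<in> Hom C X Y" "Add C g f = Zero C X Y" "Add C f g = Zero C X Y"
proof -
  interpret H: comm_group "Hom_group C X Y"
    using Hom_comm_group Hom_Obj[OF assms] by blast
  have "f \<in> carrier (Hom_group C X Y)"
    using assms by (simp add: Hom_group_def)
  then have "inv\<^bsub>Hom_group C X Y\<^esub> f \<in> carrier (Hom_group C X Y)"
    "inv\<^bsub>Hom_group C X Y\<^esub> f \<otimes>\<^bsub>Hom_group C X Y\<^esub> f = \<one>\<^bsub>Hom_group C X Y\<^esub>"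
    "f \<otimes>\<^bsub>Hom_group C X Y\<^esub> inv\<^bsub>Hom_group C X Y\<^esub> f = \<one>\<^bsub>Hom_group C X Y\<^esub>"
    by (auto intro: H.l_inv H.r_inv)
  with that[of "inv\<^bsub>Hom_group C X Y\<^esub> f"] show thesis
    by (simp add: Hom_group_def)
qed

lemma Add_right_cancel:
  assumes "f \<in> Hom C X Y" "g \<in> Hom C X Y" "h \<in> Hom C X Y" "Add C f h = Add C g h"
  shows "f = g"
proof -
  obtain h' where h': "h' \<in> Hom C X Y" "Add C h h' = Zero C X Y"
    using Add_inverse[OF assms(3)] by metis
  have "Add C (Add C f h) h' = Add C (Add C g h) h'"
    using assms(4) by simp
  then show ?thesis
    using Add_assoc[OF assms(1,3) h'(1)] Add_assoc[OF assms(2,3) h'(1)] h'(2)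
      Add_Zero_right[OF assms(1)] Add_Zero_right[OF assms(2)] by simp
qed

text \<open>Cancel \<open>f\<close> from f + f = 0 + f. Composition and additive functors both turn
  0 + 0 = 0 into such an equation, which is how they are shown to preserve zero arrows.\<close>

lemma idempotent_Zero:
  assumes "f \<in> Hom C X Y" "Add C f f = f"
  shows "f = Zero C X Y"
  using assms Add_right_cancel[OF assms(1) _ assms(1)] Zero_closed Hom_Obj[OF assms(1)]
  by (metis Add_Zero_left)

lemma Comp_Zero_right:
  assumes "g \<in> Hom C Y Z" "X \<in> Obj C"
  shows "g \<cdot> Zero C X Y = Zero C X Z"
proof -
  have z: "Zero C X Y \<in> Hom C X Y"
    using Zero_closed assms Hom_Obj by blast
  show ?thesis
    using idempotent_Zero[OF Comp_closed[OF z assms(1)]] Comp_Add_right[OF z z assms(1)]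
      Add_Zero_left[OF z] by simp
qed

lemma Comp_Zero_left:
  assumes "f \<in> Hom C X Y" "Z \<in> Obj C"
  shows "Zero C Y Z \<cdot> f = Zero C X Z"
proof -
  have z: "Zero C Y Z \<in> Hom C Y Z"
    using Zero_closed assms Hom_Obj by blast
  show ?thesis
    using idempotent_Zero[OF Comp_closed[OF assms(1) z]] Comp_Add_left[OF assms(1) z z]
      Add_Zero_left[OF z] by simp
qed

text \<open>Test the difference of \<open>u\<close> and \<open>v\<close>: with \<open>v'\<close> the
  additive inverse of \<open>v\<close>, the sum u + v' is annihilated by \<open>m\<close>, so u + v'
  = 0 = v + v', and \<open>v'\<close> cancels.\<close>

lemma monomorphismI_Zero:
  assumes m: "m \<in> Hom C X Y"
    and zero: "\<And>W h. \<lbrakk>h \<in> Hom C W X; m \<cdot> h = Zero C W Y\<rbrakk> \<Longrightarrow> h = Zero C W X"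
  shows "monomorphism C m"
proof (rule monomorphismI[OF m])
  fix W u v
  assume u: "u \<in> Hom C W X" and v: "v \<in> Hom C W X" and eq: "m \<cdot> u = m \<cdot> v"
  obtain v' where v': "v' \<in> Hom C W X" "Add C v v' = Zero C W X"
    using Add_inverse[OF v] by metis
  have "m \<cdot> Add C u v' = m \<cdot> Add C v v'"
    using eq by (simp add: Comp_Add_right[OF u v'(1) m] Comp_Add_right[OF v v'(1) m])
  also have "\<dots> = Zero C W Y"
    using v' Comp_Zero_right[OF m] Hom_Obj[OF u] by simp
  finally have "Add C u v' = Add C v v'"
    using zero[OF Add_closed[OF u v'(1)]] v' by simp
  then show "u = v"
    using Add_right_cancel u v v' by blast
qed

lemma epimorphismI_Zero:
  assumes e: "e \<in> Hom C X Y"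
    and zero: "\<And>W h. \<lbrakk>h \<in> Hom C Y W; h \<cdot> e = Zero C X W\<rbrakk> \<Longrightarrow> h = Zero C Y W"
  shows "epimorphism C e"
proof (rule epimorphismI[OF e])
  fix W u v
  assume u: "u \<in> Hom C Y W" and v: "v \<in> Hom C Y W" and eq: "u \<cdot> e = v \<cdot> e"
  obtain v' where v': "v' \<in> Hom C Y W" "Add C v v' = Zero C Y W"
    using Add_inverse[OF v] by metis
  have "Add C u v' \<cdot> e = Add C v v' \<cdot> e"
    using eq by (simp add: Comp_Add_left[OF e u v'(1)] Comp_Add_left[OF e v v'(1)])
  also have "\<dots> = Zero C X W"
    using v' Comp_Zero_left[OF e] Hom_Obj[OF u] by simp
  finally have "Add C u v' = Add C v v'"
    using zero[OF Add_closed[OF u v'(1)]] v' by simp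
  then show "u = v"
    using Add_right_cancel u v v' by blast
qed

text \<open>Uniqueness of factorizations is separated off as monicity of \<open>k\<close>, so that
  it can be supplied independently of their existence.\<close>

lemma is_kernelI:
  assumes f: "f \<in> Hom C X Y" and k: "k \<in> Hom C K X" and "f \<cdot> k = Zero C K Y"
    and mono: "monomorphism C k"
    and lift: "\<And>W h. \<lbrakk>h \<in> Hom C W X; f \<cdot> h = Zero C W Y\<rbrakk> \<Longrightarrow> \<exists>u \<in> Hom C W K. k \<cdot> u = h"
  shows "is_kernel C k f"
proof -
  have "\<exists>!u. u \<in> Hom C W K \<and> k \<cdot> u = h" if "h \<in> Hom C W X" "f \<cdot> h = Zero C W Y" for W h
    using lift[OF that] monomorphismD[OF mono k] by metis
  moreover have "Dom C f = X" "Cod C f = Y" "Dom C k = K" "Cod C k = X" "f \<in> Arr C" "k \<in> Arr C"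
    using f k by (auto simp: Hom_def)
  ultimately show ?thesis
    using assms(3) by (simp add: is_kernel_def)
qed

text \<open>Monicity comes from the uniqueness clause: if k u = k v, this common arrow is
  annihilated by \<open>f\<close>, and \<open>u\<close> and \<open>v\<close> are two factorizations
  of it. The domain \<open>K\<close> is left anonymous; users identify it with the domain they
  expect through \<open>Hom_def\<close>.\<close>

lemma is_kernelE:
  assumes "is_kernel C k f" "f \<in> Hom C X Y"
  obtains K where "k \<in> Hom C K X" "f \<cdot> k = Zero C K Y" "monomorphism C k"
    "\<And>W h. \<lbrakk>h \<in> Hom C W X; f \<cdot> h = Zero C W Y\<rbrakk> \<Longrightarrow> \<exists>u \<in> Hom C W K. k \<cdot> u = h"
proof -
  have fs: "Dom C f = X" "Cod C f = Y"
    using assms(2) by (auto simp: Hom_def)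
  have k: "k \<in> Hom C (Dom C k) X" and fk: "f \<cdot> k = Zero C (Dom C k) Y"
    and ex1: "\<And>W h. \<lbrakk>h \<in> Hom C W X; f \<cdot> h = Zero C W Y\<rbrakk>
        \<Longrightarrow> \<exists>!u. u \<in> Hom C W (Dom C k) \<and> k \<cdot> u = h"
    using assms(1) unfolding is_kernel_def fs by (auto simp: Hom_def)
  have "monomorphism C k"
  proof (rule monomorphismI[OF k])
    fix W u v
    assume u: "u \<in> Hom C W (Dom C k)" and v: "v \<in> Hom C W (Dom C k)" and eq: "k \<cdot> u = k \<cdot> v"
    have "f \<cdot> (k \<cdot> u) = Zero C W Y"
      using Comp_assoc[OF u k assms(2)] fk Comp_Zero_left[OF u] Hom_Obj[OF assms(2)] by simp
    then show "u = v"
      using ex1[OF Comp_closed[OF u k]] u v eq by metis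
  qed
  with k fk ex1 show thesis
    by (intro that[of "Dom C k"]) blast+
qed

lemma is_cokernelI:
  assumes f: "f \<in> Hom C X Y" and c: "c \<in> Hom C Y Q" and "c \<cdot> f = Zero C X Q"
    and epi: "epimorphism C c"
    and desc: "\<And>W h. \<lbrakk>h \<in> Hom C Y W; h \<cdot> f = Zero C X W\<rbrakk> \<Longrightarrow> \<exists>u \<in> Hom C Q W. u \<cdot> c = h"
  shows "is_cokernel C c f"
proof -
  have "\<exists>!u. u \<in> Hom C Q W \<and> u \<cdot> c = h" if "h \<in> Hom C Y W" "h \<cdot> f = Zero C X W" for W h
    using desc[OF that] epimorphismD[OF epi c] by metis
  moreover have "Dom C f = X" "Cod C f = Y" "Dom C c = Y" "Cod C c = Q" "f \<in> Arr C" "c \<in> Arr C"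
    using f c by (auto simp: Hom_def)
  ultimately show ?thesis
    using assms(3) by (simp add: is_cokernel_def)
qed

lemma is_cokernelE:
  assumes "is_cokernel C c f" "f \<in> Hom C X Y"
  obtains Q where "c \<in> Hom C Y Q" "c \<cdot> f = Zero C X Q" "epimorphism C c"
    "\<And>W h. \<lbrakk>h \<in> Hom C Y W; h \<cdot> f = Zero C X W\<rbrakk> \<Longrightarrow> \<exists>u \<in> Hom C Q W. u \<cdot> c = h"
proof -
  have fs: "Dom C f = X" "Cod C f = Y"
    using assms(2) by (auto simp: Hom_def)
  have c: "c \<in> Hom C Y (Cod C c)" and cf: "c \<cdot> f = Zero C X (Cod C c)"
    and ex1: "\<And>W h. \<lbrakk>h \<in> Hom C Y W; h \<cdot> f = Zero C X W\<rbrakk>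
        \<Longrightarrow> \<exists>!u. u \<in> Hom C (Cod C c) W \<and> u \<cdot> c = h"
    using assms(1) unfolding is_cokernel_def fs by (auto simp: Hom_def)
  have "epimorphism C c"
  proof (rule epimorphismI[OF c])
    fix W u v
    assume u: "u \<in> Hom C (Cod C c) W" and v: "v \<in> Hom C (Cod C c) W" and eq: "u \<cdot> c = v \<cdot> c"
    have "(u \<cdot> c) \<cdot> f = Zero C X W"
      using Comp_assoc[OF assms(2) c u] cf Comp_Zero_right[OF u] Hom_Obj[OF assms(2)] by simp
    then show "u = v"
      using ex1[OF Comp_closed[OF c u]] u v eq by metis
  qed
  with c cf ex1 show thesis
    by (intro that[of "Cod C c"]) blast+
qed

text \<open>Whatever \<open>m\<close> annihilates factors through its kernel, hence through a zero
  arrow.\<close>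

lemma kernel_Zero_imp_mono:
  assumes m: "m \<in> Hom C X Y" and ker: "is_kernel C k m" and k: "k \<in> Hom C K X"
    and zero: "k = Zero C K X"
  shows "monomorphism C m"
proof (rule monomorphismI_Zero[OF m])
  fix W h
  assume h: "h \<in> Hom C W X" "m \<cdot> h = Zero C W Y"
  obtain K' where "k \<in> Hom C K' X"
    "\<And>W h. \<lbrakk>h \<in> Hom C W X; m \<cdot> h = Zero C W Y\<rbrakk> \<Longrightarrow> \<exists>u \<in> Hom C W K'. k \<cdot> u = h"
    using is_kernelE[OF ker m] by metis
  moreover from this have "K' = K"
    using k by (simp add: Hom_def)
  ultimately obtain u where "u \<in> Hom C W K" "k \<cdot> u = h"
    using h by blast
  then show "h = Zero C W X"
    using zero Comp_Zero_left Hom_Obj[OF m] by metis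
qed

lemma cokernel_Zero_imp_epi:
  assumes e: "e \<in> Hom C X Y" and coker: "is_cokernel C c e" and c: "c \<in> Hom C Y Q"
    and zero: "c = Zero C Y Q"
  shows "epimorphism C e"
proof (rule epimorphismI_Zero[OF e])
  fix W h
  assume h: "h \<in> Hom C Y W" "h \<cdot> e = Zero C X W"
  obtain Q' where "c \<in> Hom C Y Q'"
    "\<And>W h. \<lbrakk>h \<in> Hom C Y W; h \<cdot> e = Zero C X W\<rbrakk> \<Longrightarrow> \<exists>u \<in> Hom C Q' W. u \<cdot> c = h"
    using is_cokernelE[OF coker e] by metis
  moreover from this have "Q' = Q"
    using c by (simp add: Hom_def)
  ultimately obtain u where "u \<in> Hom C Q W" "u \<cdot> c = h"
    using h by blast
  then show "h = Zero C Y W"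
    using zero Comp_Zero_right Hom_Obj[OF e] by metis
qed

lemma zero_object_Hom_from:
  assumes "zero_object C Z" "f \<in> Hom C Z X" "g \<in> Hom C Z X"
  shows "f = g"
  using assms Hom_Obj[OF assms(2)] unfolding zero_object_def by metis

lemma zero_object_Hom_to:
  assumes "zero_object C Z" "f \<in> Hom C X Z" "g \<in> Hom C X Z"
  shows "f = g"
  using assms Hom_Obj[OF assms(2)] unfolding zero_object_def by metis

text \<open>Composing w with i p + j q = 1 gives w = (w i) p + (w j) q, so w is determined by its
  restrictions along \<open>i\<close> and \<open>j\<close>.\<close>

lemma biproduct_jointly_epi:
  assumes bp: "is_biproduct C X Y P p q i j" and u: "u \<in> Hom C P W" and v: "v \<in> Hom C P W"
    and eq: "u \<cdot> i = v \<cdot> i" "u \<cdot> j = v \<cdot> j"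
  shows "u = v"
proof -
  have b: "p \<in> Hom C P X" "q \<in> Hom C P Y" "i \<in> Hom C X P" "j \<in> Hom C Y P"
    and id: "Add C (i \<cdot> p) (j \<cdot> q) = Idt C P"
    using bp by (auto simp: is_biproduct_def)
  have "w = Add C ((w \<cdot> i) \<cdot> p) ((w \<cdot> j) \<cdot> q)" if w: "w \<in> Hom C P W" for w
    using Comp_Add_right[OF Comp_closed[OF b(1,3)] Comp_closed[OF b(2,4)] w]
      Comp_Idt_right[OF w] Comp_assoc[OF b(1,3) w] Comp_assoc[OF b(2,4) w] id by simp
  from this[OF u] this[OF v] eq show ?thesis
    by simp
qed

end

section \<open>Normal monomorphisms and epimorphisms, and left exact sequences as kernels\<close>

context abelian_category
begin

text \<open>The axiom provides some \<open>f\<close> with kernel \<open>m\<close>. As f m = 0,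
  \<open>f\<close> factors through the cokernel \<open>c\<close>; so whatever \<open>c\<close>
  annihilates is annihilated by \<open>f\<close> as well and factors through
  \<open>m\<close>.\<close>

lemma mono_is_kernel_of_cokernel:
  assumes m: "m \<in> Hom C X Y" and mono: "monomorphism C m" and coker: "is_cokernel C c m"
  shows "is_kernel C m c"
proof -
  obtain f where ker: "is_kernel C m f"
    using mono_is_kernel[OF mono] by blast
  have f: "f \<in> Hom C Y (Cod C f)"
    using ker m by (auto simp: is_kernel_def Hom_def)
  obtain X' where "m \<in> Hom C X' Y" and fm: "f \<cdot> m = Zero C X' (Cod C f)"
    and lift: "\<And>W h. \<lbrakk>h \<in> Hom C W Y; f \<cdot> h = Zero C W (Cod C f)\<rbrakk> \<Longrightarrow> \<exists>u \<in> Hom C W X'. m \<cdot> u = h"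
    using is_kernelE[OF ker f] by metis
  then have X': "X' = X"
    using m by (simp add: Hom_def)
  obtain Q where c: "c \<in> Hom C Y Q" and cm: "c \<cdot> m = Zero C X Q"
    and desc: "\<And>W h. \<lbrakk>h \<in> Hom C Y W; h \<cdot> m = Zero C X W\<rbrakk> \<Longrightarrow> \<exists>u \<in> Hom C Q W. u \<cdot> c = h"
    using is_cokernelE[OF coker m] by metis
  obtain u where u: "u \<in> Hom C Q (Cod C f)" "u \<cdot> c = f"
    using desc[OF f] fm X' by blast
  show ?thesis
  proof (rule is_kernelI[OF c m cm mono])
    fix W h
    assume h: "h \<in> Hom C W Y" "c \<cdot> h = Zero C W Q"
    have "f \<cdot> h = Zero C W (Cod C f)"
      using u h Comp_assoc[OF h(1) c u(1)] Comp_Zero_right[OF u(1)] Hom_Obj[OF h(1)] by simp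
    then show "\<exists>u \<in> Hom C W X. m \<cdot> u = h"
      using lift h X' by blast
  qed
qed

text \<open>Dually, \<open>e\<close> is the cokernel of some \<open>f\<close>, which factors through
  the kernel \<open>k\<close>; so whatever annihilates \<open>k\<close> annihilates \<open>f\<close>
  and factors through \<open>e\<close>.\<close>

lemma epi_is_cokernel_of_kernel:
  assumes e: "e \<in> Hom C X Y" and epi: "epimorphism C e" and ker: "is_kernel C k e"
  shows "is_cokernel C e k"
proof -
  obtain f where coker: "is_cokernel C e f"
    using epi_is_cokernel[OF epi] by blast
  have f: "f \<in> Hom C (Dom C f) X"
    using coker e by (auto simp: is_cokernel_def Hom_def)
  obtain Y' where "e \<in> Hom C X Y'" and ef: "e \<cdot> f = Zero C (Dom C f) Y'"
    and desc: "\<And>W h. \<lbrakk>h \<in> Hom C X W; h \<cdot> f = Zero C (Dom C f) W\<rbrakk> \<Longrightarrow> \<exists>u \<in> Hom C Y' W. u \<cdot> e = h"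
    using is_cokernelE[OF coker f] by metis
  then have Y': "Y' = Y"
    using e by (simp add: Hom_def)
  obtain K where k: "k \<in> Hom C K X" and ek: "e \<cdot> k = Zero C K Y"
    and lift: "\<And>W h. \<lbrakk>h \<in> Hom C W X; e \<cdot> h = Zero C W Y\<rbrakk> \<Longrightarrow> \<exists>u \<in> Hom C W K. k \<cdot> u = h"
    using is_kernelE[OF ker e] by metis
  obtain u where u: "u \<in> Hom C (Dom C f) K" "k \<cdot> u = f"
    using lift[OF f] ef Y' by blast
  show ?thesis
  proof (rule is_cokernelI[OF k e ek epi])
    fix W h
    assume h: "h \<in> Hom C X W" "h \<cdot> k = Zero C K W"
    have "h \<cdot> f = Zero C (Dom C f) W"
      using u h Comp_assoc[OF u(1) k h(1)] Comp_Zero_left[OF u(1)] Hom_Obj[OF h(1)] by simp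
    then show "\<exists>u \<in> Hom C Y W. u \<cdot> e = h"
      using desc h Y' by blast
  qed
qed

lemma mono_is_image_self:
  assumes "m \<in> Hom C X Y" "monomorphism C m"
  shows "is_image C m m"
  using assms has_cokernels mono_is_kernel_of_cokernel
  by (metis is_image_def monomorphism_def)

text \<open>Puts a kernel into the form to which \<open>left_exact\<close> applies. The arrow from a
  zero object and \<open>k\<close> are both monic, so each is its own image, and the former is the
  kernel of \<open>k\<close> because \<open>k\<close> is monic.\<close>

lemma kernel_left_exact_sequence:
  assumes f: "f \<in> Hom C X Y" and ker: "is_kernel C k f"
  shows "left_exact_sequence C k f"
proof -
  obtain K where k: "k \<in> Hom C K X" and mono: "monomorphism C k"
    using is_kernelE[OF ker f] by metis
  obtain Z where Z: "zero_object C Z"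
    using has_zero_object by blast
  have ob: "Z \<in> Obj C" "K \<in> Obj C" "X \<in> Obj C"
    using Z Hom_Obj[OF k] by (auto simp: zero_object_def)
  have z: "Zero C Z K \<in> Hom C Z K"
    using ob Zero_closed by blast
  have z_mono: "monomorphism C (Zero C Z K)"
    using monomorphismI[OF z] zero_object_Hom_to[OF Z] by blast
  have "is_kernel C (Zero C Z K) k"
  proof (rule is_kernelI[OF k z _ z_mono])
    show "k \<cdot> Zero C Z K = Zero C Z X"
      using Comp_Zero_right[OF k ob(1)] .
    fix W h
    assume h: "h \<in> Hom C W K" "k \<cdot> h = Zero C W X"
    have W: "W \<in> Obj C"
      using Hom_Obj[OF h(1)] by simp
    have "h = Zero C W K"
      using monomorphismD[OF mono k h(1) Zero_closed[OF W ob(2)]] h Comp_Zero_right[OF k W] by simp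
    moreover have "Zero C Z K \<cdot> Zero C W Z = Zero C W K"
      using Comp_Zero_right[OF z W] .
    ultimately show "\<exists>u \<in> Hom C W Z. Zero C Z K \<cdot> u = h"
      using Zero_closed[OF W ob(1)] by blast
  qed
  then have "exact_pair C (Zero C Z K) k"
    using mono_is_image_self[OF z z_mono] by (auto simp: exact_pair_def)
  moreover have "exact_pair C k f"
    using mono_is_image_self[OF k mono] ker by (auto simp: exact_pair_def)
  moreover have "Dom C k = K"
    using k by (simp add: Hom_def)
  ultimately show ?thesis
    using Z by (auto simp: left_exact_sequence_def)
qed

text \<open>Exactness at \<open>K\<close> makes the kernel of \<open>k\<close> an image of a zero
  arrow, hence zero, so \<open>k\<close> is monic. Exactness at \<open>X\<close> gives an
  \<open>m\<close> that is a kernel both of \<open>f\<close> and of the cokernel \<open>d\<close> of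
  \<open>k\<close>; the monic \<open>k\<close> is a kernel of \<open>d\<close> too, so the property
  of \<open>m\<close> passes to \<open>k\<close>.\<close>

lemma left_exact_sequence_kernel:
  assumes k: "k \<in> Hom C K X" and f: "f \<in> Hom C X Y" and seq: "left_exact_sequence C k f"
  shows "is_kernel C k f"
proof -
  have "Dom C k = K"
    using k by (simp add: Hom_def)
  then obtain Z where Z: "zero_object C Z" and "exact_pair C (Zero C Z K) k"
    using seq by (auto simp: left_exact_sequence_def)
  then obtain z c where coker: "is_cokernel C c (Zero C Z K)" and kerc: "is_kernel C z c"
    and kerk: "is_kernel C z k"
    by (auto simp: exact_pair_def is_image_def)
  have ob: "Z \<in> Obj C" "K \<in> Obj C" "X \<in> Obj C"
    using Z Hom_Obj[OF k] by (auto simp: zero_object_def)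
  have ZK: "Zero C Z K \<in> Hom C Z K"
    using ob Zero_closed by blast
  obtain Q where c: "c \<in> Hom C K Q"
    and desc: "\<And>W h. \<lbrakk>h \<in> Hom C K W; h \<cdot> Zero C Z K = Zero C Z W\<rbrakk> \<Longrightarrow> \<exists>u \<in> Hom C Q W. u \<cdot> c = h"
    using is_cokernelE[OF coker ZK] by metis
  \<comment> \<open>The identity of \<open>K\<close> composed with the zero arrow is zero, so it
    factors through the cokernel \<open>c\<close>. Thus \<open>c\<close> is split monic, and its
    kernel \<open>z\<close> must vanish.\<close>
  obtain r where r: "r \<in> Hom C Q K" "r \<cdot> c = Idt C K"
    using desc[OF Idt_closed[OF ob(2)]] Comp_Zero_right[OF Idt_closed[OF ob(2)] ob(1)] by blast
  obtain N where z: "z \<in> Hom C N K" "c \<cdot> z = Zero C N Q"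
    using is_kernelE[OF kerc c] by metis
  have "z = (r \<cdot> c) \<cdot> z"
    using r Comp_Idt_left[OF z(1)] by simp
  also have "\<dots> = Zero C N K"
    using Comp_assoc[OF z(1) c r(1)] z Comp_Zero_right[OF r(1)] Hom_Obj[OF z(1)] by simp
  finally have mono: "monomorphism C k"
    using kernel_Zero_imp_mono[OF k kerk z(1)] by blast
  obtain m d where d_coker: "is_cokernel C d k" and kerd: "is_kernel C m d"
    and kerf: "is_kernel C m f"
    using seq by (auto simp: left_exact_sequence_def exact_pair_def is_image_def)
  obtain Q' where d: "d \<in> Hom C X Q'" and dk: "d \<cdot> k = Zero C K Q'"
    using is_cokernelE[OF d_coker k] by metis
  obtain M where m: "m \<in> Hom C M X" and dm: "d \<cdot> m = Zero C M Q'"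
    and lift_d: "\<And>W h. \<lbrakk>h \<in> Hom C W X; d \<cdot> h = Zero C W Q'\<rbrakk> \<Longrightarrow> \<exists>u \<in> Hom C W M. m \<cdot> u = h"
    using is_kernelE[OF kerd d] by metis
  obtain M' where "m \<in> Hom C M' X" and fm: "f \<cdot> m = Zero C M' Y"
    and lift_f: "\<And>W h. \<lbrakk>h \<in> Hom C W X; f \<cdot> h = Zero C W Y\<rbrakk> \<Longrightarrow> \<exists>u \<in> Hom C W M'. m \<cdot> u = h"
    using is_kernelE[OF kerf f] by metis
  then have M': "M' = M"
    using m by (simp add: Hom_def)
  \<comment> \<open>This factorization through \<open>m\<close> yields f k = f m u = 0
    below.\<close>
  obtain u where u: "u \<in> Hom C K M" "m \<cdot> u = k"
    using lift_d[OF k dk] by blast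
  have "is_kernel C k d"
    using mono_is_kernel_of_cokernel[OF k mono d_coker] .
  then obtain K' where "k \<in> Hom C K' X"
    and lift_k: "\<And>W h. \<lbrakk>h \<in> Hom C W X; d \<cdot> h = Zero C W Q'\<rbrakk> \<Longrightarrow> \<exists>u \<in> Hom C W K'. k \<cdot> u = h"
    using is_kernelE[OF _ d] by metis
  then have K': "K' = K"
    using k by (simp add: Hom_def)
  show ?thesis
  proof (rule is_kernelI[OF f k _ mono])
    show "f \<cdot> k = Zero C K Y"
      using Comp_assoc[OF u(1) m f] u fm M' Comp_Zero_left[OF u(1)] Hom_Obj[OF f] by simp
    fix W h
    assume h: "h \<in> Hom C W X" "f \<cdot> h = Zero C W Y"
    then obtain v where v: "v \<in> Hom C W M" "m \<cdot> v = h"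
      using lift_f M' by blast
    have "d \<cdot> h = Zero C W Q'"
      using Comp_assoc[OF v(1) m d] v dm Comp_Zero_left[OF v(1)] Hom_Obj[OF d] by simp
    then show "\<exists>u \<in> Hom C W K. k \<cdot> u = h"
      using lift_k h K' by blast
  qed
qed

end

text \<open>The sequence 0, K, X, Y is the bridge: abelianness of \<open>C\<close> turns the kernel
  into an exact sequence, and abelianness of \<open>D\<close> turns the image sequence back into a
  kernel.\<close>

lemma left_exact_preserves_kernels:
  assumes "abelian_category C" "abelian_category D" "covariant_functor C D F" "left_exact C D F"
    and ker: "is_kernel C k f"
  shows "is_kernel D (FArr F k) (FArr F f)"
proof -
  interpret C: abelian_category C by fact
  interpret D: abelian_category D by fact
  interpret F: covariant_functor C D F by fact
  have f: "f \<in> Hom C (Dom C f) (Cod C f)" and k: "k \<in> Hom C (Dom C k) (Dom C f)"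
    using ker by (auto simp: is_kernel_def Hom_def)
  have "left_exact_sequence D (FArr F k) (FArr F f)"
    using C.kernel_left_exact_sequence[OF f ker] assms(4) by (auto simp: left_exact_def)
  then show ?thesis
    using D.left_exact_sequence_kernel F.FArr_closed[OF f] F.FArr_closed[OF k] by blast
qed

lemma (in additive_functor) FArr_Zero:
  assumes "X \<in> Obj C" "Y \<in> Obj C"
  shows "FArr F (Zero C X Y) = Zero D (FObj F X) (FObj F Y)"
proof -
  have z: "Zero C X Y \<in> Hom C X Y"
    using assms source.Zero_closed by blast
  show ?thesis
    using FArr_Add[OF z z] source.Add_Zero_left[OF z] target.idempotent_Zero[OF FArr_closed[OF z]]
    by simp
qed

section \<open>The extension category\<close>

locale left_extension = abelian_category A
  for A :: "('o, 'm, 'z) preadditive_cat_scheme" (structure) +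
  fixes n :: nat
    and G :: "nat \<Rightarrow> ('o, 'm, 'o, 'm) func"
    and \<Psi> :: "nat \<Rightarrow> nat \<Rightarrow> 'o \<Rightarrow> 'm"
  assumes functors: "i \<in> {1..n} \<Longrightarrow> additive_functor A A (G i)"
    and natural: "natural_family A n G \<Psi>"
    and exact: "i \<in> {1..n} \<Longrightarrow> left_exact A A (G i)"
begin

section \<open>The extension expressed through arrows and families of \<open>A\<close>\<close>

abbreviation E where "E \<equiv> left_trivial_extension A n G \<Psi>"

lemma G_functor: "i \<in> {1..n} \<Longrightarrow> covariant_functor A A (G i)"
  using functors additive_functor.axioms by blast

lemmas G_Obj = covariant_functor.FObj_closed[OF G_functor]
lemmas G_Hom = covariant_functor.FArr_closed[OF G_functor]
lemmas G_Idt = covariant_functor.FArr_Idt[OF G_functor]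
lemmas G_Comp = covariant_functor.FArr_Comp[OF G_functor]
lemmas G_Add = additive_functor.FArr_Add[OF functors]
lemmas G_Zero = additive_functor.FArr_Zero[OF functors]

text \<open>This is the only form in which left exactness enters the constructions below.\<close>

lemma G_kernel: "\<lbrakk>i \<in> {1..n}; is_kernel A k f\<rbrakk> \<Longrightarrow> is_kernel A (FArr (G i) k) (FArr (G i) f)"
  using left_exact_preserves_kernels[OF abelian_category_axioms abelian_category_axioms G_functor exact] .

lemma kernel_mono: "is_kernel A k f \<Longrightarrow> monomorphism A k"
  using is_kernelE Arr_Hom by (metis is_kernel_def)

lemma
  assumes "i \<in> {1..n}" "j \<in> {1..n}" "i + j \<le> n"
  shows Psi_Hom: "X \<in> Obj A \<Longrightarrow> \<Psi> i j X \<in> Hom A (FObj (G (i + j)) X) (FObj (G i) (FObj (G j) X))"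
    and Psi_natural: "f \<in> Hom A X Y \<Longrightarrow>
      \<Psi> i j Y \<cdot> FArr (G (i + j)) f = FArr (G i) (FArr (G j) f) \<cdot> \<Psi> i j X"
proof -
  interpret natural_transformation A A "G (i + j)" "func_comp (G i) (G j)" "\<Psi> i j"
    using natural assms unfolding natural_family_def by auto
  show "X \<in> Obj A \<Longrightarrow> \<Psi> i j X \<in> Hom A (FObj (G (i + j)) X) (FObj (G i) (FObj (G j) X))"
    using component_closed by (simp add: func_comp_def)
  show "f \<in> Hom A X Y \<Longrightarrow>
      \<Psi> i j Y \<cdot> FArr (G (i + j)) f = FArr (G i) (FArr (G j) f) \<cdot> \<Psi> i j X"
    using naturality by (simp add: func_comp_def)
qed

text \<open>Only the typing of the components: neither extensionality nor the structure identity is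
  included, so the notion applies to families still under construction.\<close>

definition family :: "'o \<Rightarrow> (nat \<Rightarrow> 'm) \<Rightarrow> bool" where
  "family X g \<longleftrightarrow> X \<in> Obj A \<and> (\<forall>i \<in> {1..n}. g i \<in> Hom A X (FObj (G i) X))"

text \<open>The right-hand side of the structure identity for both ranges of i + j, which makes the
  condition on objects a single equation.\<close>

definition comult :: "nat \<Rightarrow> nat \<Rightarrow> 'o \<Rightarrow> (nat \<Rightarrow> 'm) \<Rightarrow> 'm" where
  "comult i j X g =
    (if i + j \<le> n then \<Psi> i j X \<cdot> g (i + j) else Zero A X (FObj (G i) (FObj (G j) X)))"

definition compatible :: "(nat \<Rightarrow> 'm) \<Rightarrow> 'm \<Rightarrow> (nat \<Rightarrow> 'm) \<Rightarrow> bool" where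
  "compatible \<alpha> \<gamma> \<beta> \<longleftrightarrow> (\<forall>i \<in> {1..n}. \<beta> i \<cdot> \<gamma> = FArr (G i) \<gamma> \<cdot> \<alpha> i)"

text \<open>The content of an arrow once the triple is unpacked; it lets arguments about the
  extension run on underlying arrows of \<open>A\<close>.\<close>

definition mor :: "'o \<times> (nat \<Rightarrow> 'm) \<Rightarrow> 'm \<Rightarrow> 'o \<times> (nat \<Rightarrow> 'm) \<Rightarrow> bool" where
  "mor P \<gamma> Q \<longleftrightarrow> P \<in> Obj E \<and> Q \<in> Obj E \<and> \<gamma> \<in> Hom A (fst P) (fst Q) \<and>
    compatible (snd P) \<gamma> (snd Q)"

lemma family_Hom: "\<lbrakk>family X g; i \<in> {1..n}\<rbrakk> \<Longrightarrow> g i \<in> Hom A X (FObj (G i) X)"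
  by (simp add: family_def)

lemma compatibleD: "\<lbrakk>compatible \<alpha> \<gamma> \<beta>; i \<in> {1..n}\<rbrakk> \<Longrightarrow> \<beta> i \<cdot> \<gamma> = FArr (G i) \<gamma> \<cdot> \<alpha> i"
  by (simp add: compatible_def)

lemma Obj_E_iff: "P \<in> Obj E \<longleftrightarrow> family (fst P) (snd P) \<and> snd P \<in> extensional {1..n} \<and>
    (\<forall>i \<in> {1..n}. \<forall>j \<in> {1..n}. FArr (G i) (snd P j) \<cdot> snd P i = comult i j (fst P) (snd P))"
  by (cases P) (auto simp: left_trivial_extension_def ext_objects_def family_def comult_def PiE_def
      Pi_def not_le)

lemma Obj_E_Obj: "P \<in> Obj E \<Longrightarrow> fst P \<in> Obj A"
  by (simp add: Obj_E_iff family_def)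

lemma Obj_E_Hom: "\<lbrakk>P \<in> Obj E; i \<in> {1..n}\<rbrakk> \<Longrightarrow> snd P i \<in> Hom A (fst P) (FObj (G i) (fst P))"
  by (simp add: Obj_E_iff family_def)

lemma Hom_E: "Hom E P Q = {(P, \<gamma>, Q) | \<gamma>. mor P \<gamma> Q}"
  by (cases P; cases Q) (auto simp: Hom_def left_trivial_extension_def ext_arrows_def mor_def compatible_def)

lemma Hom_E_cases:
  assumes "f \<in> Hom E P Q"
  obtains \<gamma> where "f = (P, \<gamma>, Q)" "mor P \<gamma> Q"
  using assms unfolding Hom_E by blast

lemma E_simps [simp]:
  "Dom E (P, \<gamma>, Q) = P" "Cod E (P, \<gamma>, Q) = Q" "Idt E P = (P, Idt A (fst P), P)"
  "Comp E (Q, \<delta>, R) (P, \<gamma>, Q') = (P, \<delta> \<cdot> \<gamma>, R)"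
  "Add E (P, \<gamma>, Q) (P', \<delta>, Q'') = (P, Add A \<gamma> \<delta>, Q)"
  "Zero E P Q = (P, Zero A (fst P) (fst Q), Q)"
  by (simp_all add: left_trivial_extension_def)

lemma Arr_E: "f \<in> Arr E \<Longrightarrow> \<exists>P \<gamma> Q. f = (P, \<gamma>, Q) \<and> mor P \<gamma> Q"
  by (auto simp: left_trivial_extension_def ext_arrows_def mor_def compatible_def)

lemma mor_Hom: "mor P \<gamma> Q \<Longrightarrow> \<gamma> \<in> Hom A (fst P) (fst Q)"
  by (simp add: mor_def)

lemma mor_Obj: "mor P \<gamma> Q \<Longrightarrow> P \<in> Obj E" "mor P \<gamma> Q \<Longrightarrow> Q \<in> Obj E"
  by (simp_all add: mor_def)

lemma mor_eq: "\<lbrakk>mor P \<gamma> Q; i \<in> {1..n}\<rbrakk> \<Longrightarrow> snd Q i \<cdot> \<gamma> = FArr (G i) \<gamma> \<cdot> snd P i"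
  by (simp add: mor_def compatible_def)

section \<open>Arrows of the extension are closed under the category and group operations\<close>

lemma mor_Idt:
  assumes "P \<in> Obj E"
  shows "mor P (Idt A (fst P)) P"
  unfolding mor_def compatible_def
  using assms Idt_closed[OF Obj_E_Obj[OF assms]] Comp_Idt_right[OF Obj_E_Hom[OF assms]]
    Comp_Idt_left[OF Obj_E_Hom[OF assms]] G_Idt[OF _ Obj_E_Obj[OF assms]] by simp

lemma mor_Comp:
  assumes f: "mor P \<gamma> Q" and g: "mor Q \<delta> R"
  shows "mor P (\<delta> \<cdot> \<gamma>) R"
  unfolding mor_def compatible_def
proof (intro conjI ballI)
  fix i
  assume i: "i \<in> {1..n}"
  note ob = mor_Obj[OF f] mor_Obj[OF g] and homs = mor_Hom[OF f] mor_Hom[OF g]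
  have "snd R i \<cdot> (\<delta> \<cdot> \<gamma>) = (FArr (G i) \<delta> \<cdot> snd Q i) \<cdot> \<gamma>"
    using Comp_assoc[OF homs Obj_E_Hom[OF ob(4) i]] mor_eq[OF g i] by simp
  also have "\<dots> = FArr (G i) \<delta> \<cdot> (FArr (G i) \<gamma> \<cdot> snd P i)"
    using Comp_assoc[OF homs(1) Obj_E_Hom[OF ob(2) i] G_Hom[OF i homs(2)]] mor_eq[OF f i] by simp
  also have "\<dots> = FArr (G i) (\<delta> \<cdot> \<gamma>) \<cdot> snd P i"
    using Comp_assoc[OF Obj_E_Hom[OF ob(1) i] G_Hom[OF i homs(1)] G_Hom[OF i homs(2)]]
      G_Comp[OF i homs] by simp
  finally show "snd R i \<cdot> (\<delta> \<cdot> \<gamma>) = FArr (G i) (\<delta> \<cdot> \<gamma>) \<cdot> snd P i" .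
qed (use assms Comp_closed in \<open>auto simp: mor_def\<close>)

lemma mor_Zero:
  assumes P: "P \<in> Obj E" and Q: "Q \<in> Obj E"
  shows "mor P (Zero A (fst P) (fst Q)) Q"
  unfolding mor_def compatible_def
proof (intro conjI ballI)
  fix i
  assume i: "i \<in> {1..n}"
  show "snd Q i \<cdot> Zero A (fst P) (fst Q) = FArr (G i) (Zero A (fst P) (fst Q)) \<cdot> snd P i"
    using Comp_Zero_right[OF Obj_E_Hom[OF Q i] Obj_E_Obj[OF P]]
      Comp_Zero_left[OF Obj_E_Hom[OF P i] G_Obj[OF i Obj_E_Obj[OF Q]]]
      G_Zero[OF i Obj_E_Obj[OF P] Obj_E_Obj[OF Q]] by simp
qed (use assms Zero_closed Obj_E_Obj in auto)

lemma mor_Add: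
  assumes f: "mor P \<gamma> Q" and g: "mor P \<delta> Q"
  shows "mor P (Add A \<gamma> \<delta>) Q"
  unfolding mor_def compatible_def
proof (intro conjI ballI)
  fix i
  assume i: "i \<in> {1..n}"
  note ob = mor_Obj[OF f] and homs = mor_Hom[OF f] mor_Hom[OF g]
  show "snd Q i \<cdot> Add A \<gamma> \<delta> = FArr (G i) (Add A \<gamma> \<delta>) \<cdot> snd P i"
    using Comp_Add_right[OF homs Obj_E_Hom[OF ob(2) i]] G_Add[OF i homs] mor_eq[OF f i] mor_eq[OF g i]
      Comp_Add_left[OF Obj_E_Hom[OF ob(1) i] G_Hom[OF i homs(1)] G_Hom[OF i homs(2)]] by simp
qed (use assms Add_closed in \<open>auto simp: mor_def\<close>)

text \<open>The additive inverse in \<open>A\<close> is compatible by cancellation: adding the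
  compatibility equation of \<open>\<gamma>\<close> to the desired one for \<open>\<delta>\<close>
  gives, by additivity, the equation for the zero arrow.\<close>

lemma mor_inverse:
  assumes f: "mor P \<gamma> Q"
  obtains \<delta> where "mor P \<delta> Q" "Add A \<delta> \<gamma> = Zero A (fst P) (fst Q)"
proof -
  note ob = mor_Obj[OF f] and hom = mor_Hom[OF f]
  obtain \<delta> where \<delta>: "\<delta> \<in> Hom A (fst P) (fst Q)" and add: "Add A \<delta> \<gamma> = Zero A (fst P) (fst Q)"
    using Add_inverse[OF hom] by metis
  have "mor P \<delta> Q"
    unfolding mor_def compatible_def
  proof (intro conjI ballI)
    fix i
    assume i: "i \<in> {1..n}"
    let ?u = "snd Q i \<cdot> \<delta>" and ?v = "FArr (G i) \<delta> \<cdot> snd P i" and ?w = "snd Q i \<cdot> \<gamma>"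
    have "Add A ?u ?w = Add A ?v ?w"
      using Comp_Add_right[OF \<delta> hom Obj_E_Hom[OF ob(2) i]] G_Add[OF i \<delta> hom] mor_eq[OF f i]
        Comp_Add_left[OF Obj_E_Hom[OF ob(1) i] G_Hom[OF i \<delta>] G_Hom[OF i hom]]
        mor_eq[OF mor_Zero[OF ob] i] add by simp
    then show "?u = ?v"
      using Add_right_cancel Comp_closed[OF \<delta> Obj_E_Hom[OF ob(2) i]]
        Comp_closed[OF Obj_E_Hom[OF ob(1) i] G_Hom[OF i \<delta>]] Comp_closed[OF hom Obj_E_Hom[OF ob(2) i]]
      by blast
  qed (use ob \<delta> in auto)
  with add that show thesis
    by blast
qed

lemma category_E: "category E"
proof
  fix f
  assume "f \<in> Arr E"
  then show "Dom E f \<in> Obj E" "Cod E f \<in> Obj E"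
    using Arr_E[of f] mor_Obj by auto
next
  show "Idt E P \<in> Hom E P P" if "P \<in> Obj E" for P
    using mor_Idt[OF that] by (simp add: Hom_E)
next
  fix P Q R f g
  assume "f \<in> Hom E P Q" "g \<in> Hom E Q R"
  then show "Comp E g f \<in> Hom E P R"
    by (elim Hom_E_cases) (simp add: Hom_E mor_Comp)
next
  fix O' P Q R f g h
  assume "f \<in> Hom E O' P" "g \<in> Hom E P Q" "h \<in> Hom E Q R"
  then show "Comp E (Comp E h g) f = Comp E h (Comp E g f)"
    by (elim Hom_E_cases) (simp add: Comp_assoc[OF mor_Hom mor_Hom mor_Hom])
next
  fix P Q f
  assume "f \<in> Hom E P Q"
  then obtain \<gamma> where f: "f = (P, \<gamma>, Q)" "mor P \<gamma> Q"
    unfolding Hom_E by blast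
  then show "Comp E f (Idt E P) = f" "Comp E (Idt E Q) f = f"
    using Comp_Idt_right[OF mor_Hom] Comp_Idt_left[OF mor_Hom] by simp_all
qed

lemma preadditive_category_E: "preadditive_category E"
proof -
  have "preadditive_category_axioms E"
  proof (rule preadditive_category_axioms.intro)
    fix P Q
    assume ob: "P \<in> Obj E" "Q \<in> Obj E"
    show "comm_group (Hom_group E P Q)"
    proof (rule comm_groupI)
      fix x
      assume "x \<in> carrier (Hom_group E P Q)"
      then obtain \<gamma> where x: "x = (P, \<gamma>, Q)" "mor P \<gamma> Q"
        by (auto simp: Hom_group_def Hom_E)
      obtain \<delta> where "mor P \<delta> Q" "Add A \<delta> \<gamma> = Zero A (fst P) (fst Q)"
        using mor_inverse[OF x(2)] .
      then show "\<exists>y \<in> carrier (Hom_group E P Q). y \<otimes>\<^bsub>Hom_group E P Q\<^esub> x = \<one>\<^bsub>Hom_group E P Q\<^esub>"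
        by (intro bexI[of _ "(P, \<delta>, Q)"]) (auto simp: Hom_group_def Hom_E x)
      show "\<one>\<^bsub>Hom_group E P Q\<^esub> \<otimes>\<^bsub>Hom_group E P Q\<^esub> x = x"
        using Add_Zero_left[OF mor_Hom[OF x(2)]] x by (simp add: Hom_group_def)
    next
      show "\<one>\<^bsub>Hom_group E P Q\<^esub> \<in> carrier (Hom_group E P Q)"
        using mor_Zero[OF ob] by (simp add: Hom_group_def Hom_E)
    next
      fix x y
      assume "x \<in> carrier (Hom_group E P Q)" "y \<in> carrier (Hom_group E P Q)"
      then obtain \<gamma> \<delta> where xy: "x = (P, \<gamma>, Q)" "mor P \<gamma> Q" "y = (P, \<delta>, Q)" "mor P \<delta> Q"
        unfolding Hom_group_def Hom_E by fastforce
      show "x \<otimes>\<^bsub>Hom_group E P Q\<^esub> y \<in> carrier (Hom_group E P Q)"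
        using mor_Add[OF xy(2,4)] xy by (simp add: Hom_group_def Hom_E)
      show "x \<otimes>\<^bsub>Hom_group E P Q\<^esub> y = y \<otimes>\<^bsub>Hom_group E P Q\<^esub> x"
        using Add_commute[OF mor_Hom[OF xy(2)] mor_Hom[OF xy(4)]] xy by (simp add: Hom_group_def)
      fix z
      assume "z \<in> carrier (Hom_group E P Q)"
      then obtain \<epsilon> where z: "z = (P, \<epsilon>, Q)" "mor P \<epsilon> Q"
        unfolding Hom_group_def Hom_E by fastforce
      show "(x \<otimes>\<^bsub>Hom_group E P Q\<^esub> y) \<otimes>\<^bsub>Hom_group E P Q\<^esub> z
          = x \<otimes>\<^bsub>Hom_group E P Q\<^esub> (y \<otimes>\<^bsub>Hom_group E P Q\<^esub> z)"
        using Add_assoc[OF mor_Hom[OF xy(2)] mor_Hom[OF xy(4)] mor_Hom[OF z(2)]] xy z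
        by (simp add: Hom_group_def)
    qed
  next
    fix P Q R f f' g
    assume "f \<in> Hom E P Q" "f' \<in> Hom E P Q" "g \<in> Hom E Q R"
    then obtain a b c where "f = (P, a, Q)" "mor P a Q" "f' = (P, b, Q)" "mor P b Q"
      "g = (Q, c, R)" "mor Q c R"
      by (elim Hom_E_cases)
    then show "Comp E g (Add E f f') = Add E (Comp E g f) (Comp E g f')"
      using Comp_Add_right[of a "fst P" "fst Q" b c "fst R"] mor_Hom by simp
  next
    fix P Q R f g g'
    assume "f \<in> Hom E P Q" "g \<in> Hom E Q R" "g' \<in> Hom E Q R"
    then obtain a b c where "f = (P, a, Q)" "mor P a Q" "g = (Q, b, R)" "mor Q b R"
      "g' = (Q, c, R)" "mor Q c R"
      by (elim Hom_E_cases)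
    then show "Comp E (Add E g g') f = Add E (Comp E g f) (Comp E g' f)"
      using Comp_Add_left[of a "fst P" "fst Q" b "fst R" c] mor_Hom by simp
  qed
  with category_E show ?thesis
    by (rule preadditive_category.intro)
qed

text \<open>Makes the general criteria for kernels, cokernels, monomorphisms and epimorphisms
  available for the extension before it is known to be abelian.\<close>

sublocale E: preadditive_category E
  by (rule preadditive_category_E)

text \<open>The two sides of the defining identity of an object are natural in the family.  Hence the
  identity passes along compatible morphisms that are cancellable on the appropriate side, which
  yields the objects underlying kernels, cokernels and biproducts alike.\<close>

lemma
  assumes fam: "family X \<alpha>" "family Y \<beta>" and f: "f \<in> Hom A X Y" and comp: "compatible \<alpha> f \<beta>"
    and i: "i \<in> {1..n}" and j: "j \<in> {1..n}"
  shows iterate_natural: "(FArr (G i) (\<beta> j) \<cdot> \<beta> i) \<cdot> f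
      = FArr (G i) (FArr (G j) f) \<cdot> (FArr (G i) (\<alpha> j) \<cdot> \<alpha> i)"
    and comult_natural: "comult i j Y \<beta> \<cdot> f = FArr (G i) (FArr (G j) f) \<cdot> comult i j X \<alpha>"
proof -
  note a = family_Hom[OF fam(1)] and b = family_Hom[OF fam(2)]
  note GGf = G_Hom[OF i G_Hom[OF j f]]
  have "(FArr (G i) (\<beta> j) \<cdot> \<beta> i) \<cdot> f = FArr (G i) (\<beta> j) \<cdot> (FArr (G i) f \<cdot> \<alpha> i)"
    using Comp_assoc[OF f b[OF i] G_Hom[OF i b[OF j]]] compatibleD[OF comp i] by simp
  also have "\<dots> = FArr (G i) (\<beta> j \<cdot> f) \<cdot> \<alpha> i"
    using Comp_assoc[OF a[OF i] G_Hom[OF i f] G_Hom[OF i b[OF j]]] G_Comp[OF i f b[OF j]] by simp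
  also have "\<dots> = (FArr (G i) (FArr (G j) f) \<cdot> FArr (G i) (\<alpha> j)) \<cdot> \<alpha> i"
    using compatibleD[OF comp j] G_Comp[OF i a[OF j] G_Hom[OF j f]] by simp
  also have "\<dots> = FArr (G i) (FArr (G j) f) \<cdot> (FArr (G i) (\<alpha> j) \<cdot> \<alpha> i)"
    using Comp_assoc[OF a[OF i] G_Hom[OF i a[OF j]] GGf] .
  finally show "(FArr (G i) (\<beta> j) \<cdot> \<beta> i) \<cdot> f
      = FArr (G i) (FArr (G j) f) \<cdot> (FArr (G i) (\<alpha> j) \<cdot> \<alpha> i)" .
  have ob: "X \<in> Obj A" "Y \<in> Obj A"
    using Hom_Obj[OF f] .
  show "comult i j Y \<beta> \<cdot> f = FArr (G i) (FArr (G j) f) \<cdot> comult i j X \<alpha>"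
  proof (cases "i + j \<le> n")
    case True
    then have ij: "i + j \<in> {1..n}"
      using i by auto
    note Psi = Psi_Hom[OF i j True]
    have "(\<Psi> i j Y \<cdot> \<beta> (i + j)) \<cdot> f = \<Psi> i j Y \<cdot> (FArr (G (i + j)) f \<cdot> \<alpha> (i + j))"
      using Comp_assoc[OF f b[OF ij] Psi[OF ob(2)]] compatibleD[OF comp ij] by simp
    \<comment> \<open>Naturality of \<open>\<Psi> i j\<close> at \<open>f\<close> exchanges
      \<open>FArr (G (i + j)) f\<close> for the iterated functor.\<close>
    also have "\<dots> = (FArr (G i) (FArr (G j) f) \<cdot> \<Psi> i j X) \<cdot> \<alpha> (i + j)"
      using Comp_assoc[OF a[OF ij] G_Hom[OF ij f] Psi[OF ob(2)]] Psi_natural[OF i j True f] by simp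
    also have "\<dots> = FArr (G i) (FArr (G j) f) \<cdot> (\<Psi> i j X \<cdot> \<alpha> (i + j))"
      using Comp_assoc[OF a[OF ij] Psi[OF ob(1)] GGf] .
    finally show ?thesis
      using True by (simp add: comult_def)
  next
    case False
    then show ?thesis
      using Comp_Zero_right[OF GGf ob(1)] Comp_Zero_left[OF f Hom_Obj(2)[OF GGf]]
      by (simp add: comult_def)
  qed
qed

lemma
  assumes fam: "family X \<alpha>" and i: "i \<in> {1..n}" and j: "j \<in> {1..n}"
  shows iterate_Hom: "FArr (G i) (\<alpha> j) \<cdot> \<alpha> i \<in> Hom A X (FObj (G i) (FObj (G j) X))"
    and comult_Hom: "comult i j X \<alpha> \<in> Hom A X (FObj (G i) (FObj (G j) X))"
proof -
  note a = family_Hom[OF fam]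
  show "FArr (G i) (\<alpha> j) \<cdot> \<alpha> i \<in> Hom A X (FObj (G i) (FObj (G j) X))"
    using Comp_closed[OF a[OF i] G_Hom[OF i a[OF j]]] .
  have X: "X \<in> Obj A"
    using fam by (simp add: family_def)
  show "comult i j X \<alpha> \<in> Hom A X (FObj (G i) (FObj (G j) X))"
  proof (cases "i + j \<le> n")
    case True
    then have ij: "i + j \<in> {1..n}"
      using i by auto
    show ?thesis
      using Comp_closed[OF a[OF ij] Psi_Hom[OF i j True X]] True by (simp add: comult_def)
  next
    case False
    then show ?thesis
      using Zero_closed[OF X G_Obj[OF i G_Obj[OF j X]]] by (simp add: comult_def)
  qed
qed

section \<open>Objects of the extension over kernels and cokernels of \<open>A\<close>\<close>

lemma Obj_E_I:
  assumes fam: "family X g"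
    and eq: "\<And>i j. \<lbrakk>i \<in> {1..n}; j \<in> {1..n}\<rbrakk> \<Longrightarrow> FArr (G i) (g j) \<cdot> g i = comult i j X g"
  shows "(X, restrict g {1..n}) \<in> Obj E"
proof -
  \<comment> \<open>The index i + j is consulted only when it is at most \<open>n\<close>, and it is
    at least 1 because \<open>i\<close> is; so restriction does not change the value.\<close>
  have "comult i j X (restrict g {1..n}) = comult i j X g" if "i \<in> {1..n}" for i j
    using that by (auto simp: comult_def)
  then show ?thesis
    using fam eq by (auto simp: Obj_E_iff family_def)
qed

lemma mor_restrict_source:
  assumes "(X, restrict g {1..n}) \<in> Obj E" "Q \<in> Obj E" "f \<in> Hom A X (fst Q)" "compatible g f (snd Q)"
  shows "mor (X, restrict g {1..n}) f Q"
  using assms by (simp add: mor_def compatible_def)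

lemma mor_restrict_target:
  assumes "(X, restrict g {1..n}) \<in> Obj E" "P \<in> Obj E" "f \<in> Hom A (fst P) X" "compatible (snd P) f g"
  shows "mor P f (X, restrict g {1..n})"
  using assms by (simp add: mor_def compatible_def)

text \<open>Preservation of kernels is used twice. Writing p and q for the families of P and Q,
  G_i(f) p_i k = q_i f k = 0, so p_i k factors through the kernel G_i(k), which defines \<kappa>_i.
  Then G_i(G_j(k)) is monic, and cancelling it carries the structure identity from \<open>P\<close>
  to \<kappa>.\<close>

lemma kernel_lift:
  assumes ker: "is_kernel A k f" and f: "mor P f Q"
  obtains R where "mor R k P"
proof -
  note ob = mor_Obj[OF f]
  obtain K where k: "k \<in> Hom A K (fst P)" and fk: "f \<cdot> k = Zero A K (fst Q)"
    using is_kernelE[OF ker mor_Hom[OF f]] by metis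
  have K: "K \<in> Obj A"
    using Hom_Obj[OF k] by simp
  have "\<exists>u \<in> Hom A K (FObj (G i) K). snd P i \<cdot> k = FArr (G i) k \<cdot> u" if i: "i \<in> {1..n}" for i
  proof -
    note Gk = G_Hom[OF i k] and Gf = G_Hom[OF i mor_Hom[OF f]]
    have p: "snd P i \<cdot> k \<in> Hom A K (FObj (G i) (fst P))"
      using Comp_closed[OF k Obj_E_Hom[OF ob(1) i]] .
    have "FArr (G i) f \<cdot> (snd P i \<cdot> k) = snd Q i \<cdot> (f \<cdot> k)"
      using Comp_assoc[OF k Obj_E_Hom[OF ob(1) i] Gf] mor_eq[OF f i]
        Comp_assoc[OF k mor_Hom[OF f] Obj_E_Hom[OF ob(2) i]] by simp
    then have "FArr (G i) f \<cdot> (snd P i \<cdot> k) = Zero A K (FObj (G i) (fst Q))"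
      using fk Comp_Zero_right[OF Obj_E_Hom[OF ob(2) i] K] by simp
    moreover obtain K' where "FArr (G i) k \<in> Hom A K' (FObj (G i) (fst P))"
      and "\<And>W h. \<lbrakk>h \<in> Hom A W (FObj (G i) (fst P)); FArr (G i) f \<cdot> h = Zero A W (FObj (G i) (fst Q))\<rbrakk>
        \<Longrightarrow> \<exists>u \<in> Hom A W K'. FArr (G i) k \<cdot> u = h"
      using is_kernelE[OF G_kernel[OF i ker] Gf] by metis
    moreover from this have "K' = FObj (G i) K"
      using Gk by (simp add: Hom_def)
    ultimately show ?thesis
      using p by metis
  qed
  then obtain \<kappa> where \<kappa>: "\<And>i. i \<in> {1..n} \<Longrightarrow> \<kappa> i \<in> Hom A K (FObj (G i) K)"
    and eq: "\<And>i. i \<in> {1..n} \<Longrightarrow> snd P i \<cdot> k = FArr (G i) k \<cdot> \<kappa> i"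
    by metis
  have fam: "family K \<kappa>" "family (fst P) (snd P)"
    using K \<kappa> ob by (auto simp: family_def Obj_E_iff)
  have comp: "compatible \<kappa> k (snd P)"
    using eq by (simp add: compatible_def)
  have R: "(K, restrict \<kappa> {1..n}) \<in> Obj E"
  proof (rule Obj_E_I[OF fam(1)])
    fix i j
    assume i: "i \<in> {1..n}" and j: "j \<in> {1..n}"
    have "FArr (G i) (snd P j) \<cdot> snd P i = comult i j (fst P) (snd P)"
      using ob i j by (simp add: Obj_E_iff)
    then have "FArr (G i) (FArr (G j) k) \<cdot> (FArr (G i) (\<kappa> j) \<cdot> \<kappa> i)
        = FArr (G i) (FArr (G j) k) \<cdot> comult i j K \<kappa>"
      using iterate_natural[OF fam k comp i j] comult_natural[OF fam k comp i j] by simp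
    then show "FArr (G i) (\<kappa> j) \<cdot> \<kappa> i = comult i j K \<kappa>"
      using monomorphismD[OF kernel_mono[OF G_kernel[OF i G_kernel[OF j ker]]] G_Hom[OF i G_Hom[OF j k]]]
        iterate_Hom[OF fam(1) i j] comult_Hom[OF fam(1) i j] by blast
  qed
  show thesis
    using that mor_restrict_source[OF R ob(1) k comp] .
qed

text \<open>With p and q the families of P and Q, G_i(c) q_i f = G_i(c f) p_i = 0, so G_i(c) q_i
  descends along \<open>c\<close>. The structure identity of \<open>Q\<close> then passes to the
  descended family by cancelling the epimorphism \<open>c\<close> itself on the right.\<close>

lemma cokernel_descend:
  assumes coker: "is_cokernel A c f" and f: "mor P f Q"
  obtains R where "mor Q c R"
proof -
  note ob = mor_Obj[OF f]
  obtain K where c: "c \<in> Hom A (fst Q) K" and cf: "c \<cdot> f = Zero A (fst P) K"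
    and epi: "epimorphism A c"
    and desc: "\<And>W h. \<lbrakk>h \<in> Hom A (fst Q) W; h \<cdot> f = Zero A (fst P) W\<rbrakk> \<Longrightarrow> \<exists>u \<in> Hom A K W. u \<cdot> c = h"
    using is_cokernelE[OF coker mor_Hom[OF f]] by metis
  have K: "K \<in> Obj A"
    using Hom_Obj[OF c] by simp
  have "\<exists>u \<in> Hom A K (FObj (G i) K). u \<cdot> c = FArr (G i) c \<cdot> snd Q i" if i: "i \<in> {1..n}" for i
  proof (rule desc)
    note Gc = G_Hom[OF i c] and Gf = G_Hom[OF i mor_Hom[OF f]]
    show "FArr (G i) c \<cdot> snd Q i \<in> Hom A (fst Q) (FObj (G i) K)"
      using Comp_closed[OF Obj_E_Hom[OF ob(2) i] Gc] .
    have "(FArr (G i) c \<cdot> snd Q i) \<cdot> f = FArr (G i) c \<cdot> (FArr (G i) f \<cdot> snd P i)"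
      using Comp_assoc[OF mor_Hom[OF f] Obj_E_Hom[OF ob(2) i] Gc] mor_eq[OF f i] by simp
    also have "\<dots> = FArr (G i) (c \<cdot> f) \<cdot> snd P i"
      using Comp_assoc[OF Obj_E_Hom[OF ob(1) i] Gf Gc] G_Comp[OF i mor_Hom[OF f] c] by simp
    also have "\<dots> = Zero A (fst P) (FObj (G i) K)"
      using cf G_Zero[OF i Obj_E_Obj[OF ob(1)] K] Comp_Zero_left[OF Obj_E_Hom[OF ob(1) i] G_Obj[OF i K]]
      by simp
    finally show "(FArr (G i) c \<cdot> snd Q i) \<cdot> f = Zero A (fst P) (FObj (G i) K)" .
  qed
  then obtain \<kappa> where \<kappa>: "\<And>i. i \<in> {1..n} \<Longrightarrow> \<kappa> i \<in> Hom A K (FObj (G i) K)"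
    and eq: "\<And>i. i \<in> {1..n} \<Longrightarrow> \<kappa> i \<cdot> c = FArr (G i) c \<cdot> snd Q i"
    by metis
  have fam: "family (fst Q) (snd Q)" "family K \<kappa>"
    using K \<kappa> ob by (auto simp: family_def Obj_E_iff)
  have comp: "compatible (snd Q) c \<kappa>"
    using eq by (simp add: compatible_def)
  have R: "(K, restrict \<kappa> {1..n}) \<in> Obj E"
  proof (rule Obj_E_I[OF fam(2)])
    fix i j
    assume i: "i \<in> {1..n}" and j: "j \<in> {1..n}"
    have "FArr (G i) (snd Q j) \<cdot> snd Q i = comult i j (fst Q) (snd Q)"
      using ob i j by (simp add: Obj_E_iff)
    then have "(FArr (G i) (\<kappa> j) \<cdot> \<kappa> i) \<cdot> c = comult i j K \<kappa> \<cdot> c"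
      using iterate_natural[OF fam c comp i j] comult_natural[OF fam c comp i j] by simp
    then show "FArr (G i) (\<kappa> j) \<cdot> \<kappa> i = comult i j K \<kappa>"
      using epimorphismD[OF epi c] iterate_Hom[OF fam(2) i j] comult_Hom[OF fam(2) i j] by blast
  qed
  show thesis
    using that mor_restrict_target[OF R ob(2) c comp] .
qed

section \<open>Universal and cancellation properties carried between \<open>A\<close> and the
  extension\<close>

lemma E_mono:
  assumes f: "mor P f Q" and mono: "monomorphism A f"
  shows "monomorphism E (P, f, Q)"
proof (rule E.monomorphismI)
  show "(P, f, Q) \<in> Hom E P Q"
    using f by (simp add: Hom_E)
  fix R u v
  assume uv: "u \<in> Hom E R P" "v \<in> Hom E R P" and eq: "Comp E (P, f, Q) u = Comp E (P, f, Q) v"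
  obtain u' v' where "u = (R, u', P)" "mor R u' P" "v = (R, v', P)" "mor R v' P"
    using uv unfolding Hom_E by blast
  with eq show "u = v"
    using monomorphismD[OF mono mor_Hom[OF f] mor_Hom[of R u' P] mor_Hom[of R v' P]] by simp
qed

lemma E_epi:
  assumes f: "mor P f Q" and epi: "epimorphism A f"
  shows "epimorphism E (P, f, Q)"
proof (rule E.epimorphismI)
  show "(P, f, Q) \<in> Hom E P Q"
    using f by (simp add: Hom_E)
  fix R u v
  assume uv: "u \<in> Hom E Q R" "v \<in> Hom E Q R" and eq: "Comp E u (P, f, Q) = Comp E v (P, f, Q)"
  obtain u' v' where "u = (Q, u', R)" "mor Q u' R" "v = (Q, v', R)" "mor Q v' R"
    using uv unfolding Hom_E by blast
  with eq show "u = v"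
    using epimorphismD[OF epi mor_Hom[OF f] mor_Hom[of Q u' R] mor_Hom[of Q v' R]] by simp
qed

text \<open>The factorization \<open>u\<close> found in \<open>A\<close> only needs to be
  compatible. After composition with the monic G_i(k), both sides of its equation become the two
  sides of the equation for h = k u.\<close>

lemma E_kernel:
  assumes ker: "is_kernel A k f" and f: "mor P f Q" and k: "mor R k P"
  shows "is_kernel E (R, k, P) (P, f, Q)"
proof -
  note Hf = mor_Hom[OF f] and Hk = mor_Hom[OF k]
  obtain K where K: "k \<in> Hom A K (fst P)" "f \<cdot> k = Zero A K (fst Q)" and mono: "monomorphism A k"
    and lift: "\<And>W h. \<lbrakk>h \<in> Hom A W (fst P); f \<cdot> h = Zero A W (fst Q)\<rbrakk> \<Longrightarrow> \<exists>u \<in> Hom A W K. k \<cdot> u = h"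
    using is_kernelE[OF ker Hf] by metis
  have KR: "K = fst R"
    using K(1) Hk by (simp add: Hom_def)
  show ?thesis
  proof (rule E.is_kernelI[OF _ _ _ E_mono[OF k mono]])
    show "(P, f, Q) \<in> Hom E P Q" "(R, k, P) \<in> Hom E R P"
      "Comp E (P, f, Q) (R, k, P) = Zero E R Q"
      using f k K KR by (simp_all add: Hom_E)
    fix S h'
    assume "h' \<in> Hom E S P" "Comp E (P, f, Q) h' = Zero E S Q"
    then obtain h where h': "h' = (S, h, P)" and h: "mor S h P" and fh: "f \<cdot> h = Zero A (fst S) (fst Q)"
      by (auto simp: Hom_E)
    note Hh = mor_Hom[OF h] and ob = mor_Obj[OF h] mor_Obj[OF k]
    obtain u where u: "u \<in> Hom A (fst S) (fst R)" "k \<cdot> u = h"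
      using lift[OF Hh fh] KR by blast
    have "mor S u R"
      unfolding mor_def compatible_def
    proof (intro conjI ballI)
      fix i
      assume i: "i \<in> {1..n}"
      note Gk = G_Hom[OF i Hk] and Gu = G_Hom[OF i u(1)]
        and s = Obj_E_Hom[OF ob(1) i] and r = Obj_E_Hom[OF ob(3) i] and p = Obj_E_Hom[OF ob(2) i]
      have "FArr (G i) k \<cdot> (snd R i \<cdot> u) = (snd P i \<cdot> k) \<cdot> u"
        using Comp_assoc[OF u(1) r Gk] mor_eq[OF k i] by simp
      also have "\<dots> = FArr (G i) (k \<cdot> u) \<cdot> snd S i"
        using Comp_assoc[OF u(1) Hk p] mor_eq[OF h i] u(2) by simp
      also have "\<dots> = FArr (G i) k \<cdot> (FArr (G i) u \<cdot> snd S i)"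
        using Comp_assoc[OF s Gu Gk] G_Comp[OF i u(1) Hk] by simp
      finally show "snd R i \<cdot> u = FArr (G i) u \<cdot> snd S i"
        using monomorphismD[OF kernel_mono[OF G_kernel[OF i ker]] Gk Comp_closed[OF u(1) r]
            Comp_closed[OF s Gu]] by blast
    qed (use ob u in auto)
    then show "\<exists>u \<in> Hom E S R. Comp E (R, k, P) u = h'"
      using u h' by (intro bexI[of _ "(S, u, R)"]) (auto simp: Hom_E)
  qed
qed

text \<open>Here compatibility of the factorization is tested after composition with
  \<open>c\<close> on the right, where it becomes the compatibility of h = u c.\<close>

lemma E_cokernel:
  assumes coker: "is_cokernel A c f" and f: "mor P f Q" and c: "mor Q c R"
  shows "is_cokernel E (Q, c, R) (P, f, Q)"
proof -
  note Hf = mor_Hom[OF f] and Hc = mor_Hom[OF c]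
  obtain K where K: "c \<in> Hom A (fst Q) K" "c \<cdot> f = Zero A (fst P) K" and epi: "epimorphism A c"
    and desc: "\<And>W h. \<lbrakk>h \<in> Hom A (fst Q) W; h \<cdot> f = Zero A (fst P) W\<rbrakk> \<Longrightarrow> \<exists>u \<in> Hom A K W. u \<cdot> c = h"
    using is_cokernelE[OF coker Hf] by metis
  have KR: "K = fst R"
    using K(1) Hc by (simp add: Hom_def)
  show ?thesis
  proof (rule E.is_cokernelI[OF _ _ _ E_epi[OF c epi]])
    show "(P, f, Q) \<in> Hom E P Q" "(Q, c, R) \<in> Hom E Q R"
      "Comp E (Q, c, R) (P, f, Q) = Zero E P R"
      using f c K KR by (simp_all add: Hom_E)
    fix S h'
    assume "h' \<in> Hom E Q S" "Comp E h' (P, f, Q) = Zero E P S"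
    then obtain h where h': "h' = (Q, h, S)" and h: "mor Q h S" and hf: "h \<cdot> f = Zero A (fst P) (fst S)"
      by (auto simp: Hom_E)
    note Hh = mor_Hom[OF h] and ob = mor_Obj[OF h] mor_Obj[OF c]
    obtain u where u: "u \<in> Hom A (fst R) (fst S)" "u \<cdot> c = h"
      using desc[OF Hh hf] KR by blast
    have "mor R u S"
      unfolding mor_def compatible_def
    proof (intro conjI ballI)
      fix i
      assume i: "i \<in> {1..n}"
      note Gc = G_Hom[OF i Hc] and Gu = G_Hom[OF i u(1)]
        and s = Obj_E_Hom[OF ob(2) i] and r = Obj_E_Hom[OF ob(4) i] and q = Obj_E_Hom[OF ob(1) i]
      have "(snd S i \<cdot> u) \<cdot> c = FArr (G i) (u \<cdot> c) \<cdot> snd Q i"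
        using Comp_assoc[OF Hc u(1) s] mor_eq[OF h i] u(2) by simp
      also have "\<dots> = FArr (G i) u \<cdot> (FArr (G i) c \<cdot> snd Q i)"
        using Comp_assoc[OF q Gc Gu] G_Comp[OF i Hc u(1)] by simp
      also have "\<dots> = (FArr (G i) u \<cdot> snd R i) \<cdot> c"
        using Comp_assoc[OF Hc r Gu] mor_eq[OF c i] by simp
      finally show "snd S i \<cdot> u = FArr (G i) u \<cdot> snd R i"
        using epimorphismD[OF epi Hc Comp_closed[OF u(1) s] Comp_closed[OF r Gu]] by blast
    qed (use ob u in auto)
    then show "\<exists>u \<in> Hom E R S. Comp E u (Q, c, R) = h'"
      using u h' by (intro bexI[of _ "(R, u, S)"]) (auto simp: Hom_E)
  qed
qed

text \<open>The kernel of \<open>f\<close> in \<open>A\<close> underlies an arrow of the extension,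
  whose composite with \<open>f\<close> equals that of the zero arrow. Cancellation in the extension
  makes this kernel zero, which suffices in \<open>A\<close>.\<close>

lemma E_mono_imp_mono:
  assumes f: "mor P f Q" and mono: "monomorphism E (P, f, Q)"
  shows "monomorphism A f"
proof -
  obtain k where ker: "is_kernel A k f"
    using has_kernels mor_Hom[OF f] by (auto simp: Hom_def)
  obtain R where k: "mor R k P"
    using kernel_lift[OF ker f] .
  have "f \<cdot> k = Zero A (fst R) (fst Q)"
    using ker mor_Hom[OF f] mor_Hom[OF k] by (auto simp: is_kernel_def Hom_def)
  moreover have "f \<cdot> Zero A (fst R) (fst P) = Zero A (fst R) (fst Q)"
    using Comp_Zero_right[OF mor_Hom[OF f] Hom_Obj(1)[OF mor_Hom[OF k]]] .
  ultimately have "Comp E (P, f, Q) (R, k, P) = Comp E (P, f, Q) (Zero E R P)"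
    by simp
  moreover have "(P, f, Q) \<in> Hom E P Q" "(R, k, P) \<in> Hom E R P"
    using f k by (simp_all add: Hom_E)
  ultimately have "(R, k, P) = Zero E R P"
    using E.monomorphismD[OF mono] E.Zero_closed[OF mor_Obj[OF k]] by blast
  then show ?thesis
    by (intro kernel_Zero_imp_mono[OF mor_Hom[OF f] ker mor_Hom[OF k]]) simp
qed

text \<open>Dually, the cokernel of \<open>f\<close> descends to the extension and is compared there
  with the zero arrow.\<close>

lemma E_epi_imp_epi:
  assumes f: "mor P f Q" and epi: "epimorphism E (P, f, Q)"
  shows "epimorphism A f"
proof -
  obtain c where coker: "is_cokernel A c f"
    using has_cokernels mor_Hom[OF f] by (auto simp: Hom_def)
  obtain R where c: "mor Q c R"
    using cokernel_descend[OF coker f] .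
  have "c \<cdot> f = Zero A (fst P) (fst R)"
    using coker mor_Hom[OF f] mor_Hom[OF c] by (auto simp: is_cokernel_def Hom_def)
  moreover have "Zero A (fst Q) (fst R) \<cdot> f = Zero A (fst P) (fst R)"
    using Comp_Zero_left[OF mor_Hom[OF f] Hom_Obj(2)[OF mor_Hom[OF c]]] .
  ultimately have "Comp E (Q, c, R) (P, f, Q) = Comp E (Zero E Q R) (P, f, Q)"
    by simp
  moreover have "(P, f, Q) \<in> Hom E P Q" "(Q, c, R) \<in> Hom E Q R"
    using f c by (simp_all add: Hom_E)
  ultimately have "(Q, c, R) = Zero E Q R"
    using E.epimorphismD[OF epi] E.Zero_closed[OF mor_Obj[OF c]] by blast
  then show ?thesis
    by (intro cokernel_Zero_imp_epi[OF mor_Hom[OF f] coker mor_Hom[OF c]]) simp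
qed

section \<open>Zero object, biproducts and the abelian axioms\<close>

lemma E_has_zero_object: "\<exists>P. zero_object E P"
proof -
  obtain Z where Z: "zero_object A Z"
    using has_zero_object by blast
  have ob: "Z \<in> Obj A"
    using Z by (simp add: zero_object_def)
  define g where "g = (\<lambda>i. Zero A Z (FObj (G i) Z))"
  have fam: "family Z g"
    using ob Zero_closed G_Obj by (simp add: family_def g_def)
  let ?P = "(Z, restrict g {1..n})"
  \<comment> \<open>Both sides of the structure identity are arrows out of the zero object
    \<open>Z\<close>, so well-typedness already makes them equal.\<close>
  have P: "?P \<in> Obj E"
    using Obj_E_I[OF fam] zero_object_Hom_from[OF Z] iterate_Hom[OF fam] comult_Hom[OF fam] by blast
  have "\<exists>!f. f \<in> Hom E Q ?P" "\<exists>!f. f \<in> Hom E ?P Q" if Q: "Q \<in> Obj E" for Q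
  proof -
    show "\<exists>!f. f \<in> Hom E Q ?P"
    proof (rule ex1I)
      show "Zero E Q ?P \<in> Hom E Q ?P"
        using mor_Zero[OF Q P] by (simp add: Hom_E)
      fix f
      assume "f \<in> Hom E Q ?P"
      then obtain \<gamma> where f: "f = (Q, \<gamma>, ?P)" "mor Q \<gamma> ?P"
        by (rule Hom_E_cases)
      then have "\<gamma> = Zero A (fst Q) Z"
        using zero_object_Hom_to[OF Z] mor_Hom[OF f(2)] mor_Hom[OF mor_Zero[OF Q P]] by simp
      then show "f = Zero E Q ?P"
        using f by simp
    qed
    show "\<exists>!f. f \<in> Hom E ?P Q"
    proof (rule ex1I)
      show "Zero E ?P Q \<in> Hom E ?P Q"
        using mor_Zero[OF P Q] by (simp add: Hom_E)
      fix f
      assume "f \<in> Hom E ?P Q"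
      then obtain \<gamma> where f: "f = (?P, \<gamma>, Q)" "mor ?P \<gamma> Q"
        by (rule Hom_E_cases)
      then have "\<gamma> = Zero A Z (fst Q)"
        using zero_object_Hom_from[OF Z] mor_Hom[OF f(2)] mor_Hom[OF mor_Zero[OF P Q]] by simp
      then show "f = Zero E ?P Q"
        using f by simp
    qed
  qed
  then have "zero_object E ?P"
    using P by (simp add: zero_object_def)
  then show ?thesis
    by blast
qed

text \<open>The biproduct of \<open>A\<close> carries the direct sum of the two families. Its
  structure identity is checked after composition with the injections, which are jointly epic;
  \<open>i\<close> and \<open>j\<close> denote these injections here, so indices are
  \<open>k\<close> and \<open>l\<close>.\<close>

lemma E_has_biproducts:
  assumes P: "P \<in> Obj E" and Q: "Q \<in> Obj E"
  shows "\<exists>S p q i j. is_biproduct E P Q S p q i j"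
proof -
  obtain S p q i j where bp: "is_biproduct A (fst P) (fst Q) S p q i j"
    using has_biproducts Obj_E_Obj P Q by blast
  have b: "p \<in> Hom A S (fst P)" "q \<in> Hom A S (fst Q)" "i \<in> Hom A (fst P) S" "j \<in> Hom A (fst Q) S"
    and id: "p \<cdot> i = Idt A (fst P)" "q \<cdot> j = Idt A (fst Q)" "p \<cdot> j = Zero A (fst Q) (fst P)"
      "q \<cdot> i = Zero A (fst P) (fst Q)" "Add A (i \<cdot> p) (j \<cdot> q) = Idt A S"
    using bp by (auto simp: is_biproduct_def)
  have S: "S \<in> Obj A"
    using Hom_Obj[OF b(1)] by simp
  note obP = Obj_E_Obj[OF P] and obQ = Obj_E_Obj[OF Q]
  \<comment> \<open>The only family compatible with both injections: it must restrict to G_k(i) p_k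
    along \<open>i\<close> and to G_k(j) q_k along \<open>j\<close>, where p and q are the given
    families.\<close>
  define g where "g = (\<lambda>k. Add A ((FArr (G k) i \<cdot> snd P k) \<cdot> p) ((FArr (G k) j \<cdot> snd Q k) \<cdot> q))"
  have fam: "family S g" "family (fst P) (snd P)" "family (fst Q) (snd Q)"
    using S P Q unfolding family_def g_def Obj_E_iff
    by (auto intro!: Add_closed Comp_closed[OF b(1)] Comp_closed[OF b(2)]
        Comp_closed[OF _ G_Hom[OF _ b(3)]] Comp_closed[OF _ G_Hom[OF _ b(4)]])
  have comps: "g k \<cdot> i = FArr (G k) i \<cdot> snd P k" "g k \<cdot> j = FArr (G k) j \<cdot> snd Q k"
    "snd P k \<cdot> p = FArr (G k) p \<cdot> g k" "snd Q k \<cdot> q = FArr (G k) q \<cdot> g k" if k: "k \<in> {1..n}" for k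
  proof -
    note x = Obj_E_Hom[OF P k] and y = Obj_E_Hom[OF Q k]
      and Gi = G_Hom[OF k b(3)] and Gj = G_Hom[OF k b(4)] and Gp = G_Hom[OF k b(1)] and Gq = G_Hom[OF k b(2)]
    note a = Comp_closed[OF x Gi] and c = Comp_closed[OF y Gj]
    note ap = Comp_closed[OF b(1) a] and cq = Comp_closed[OF b(2) c]
    note GP = G_Obj[OF k obP] and GQ = G_Obj[OF k obQ] and GS = G_Obj[OF k S]
    show "g k \<cdot> i = FArr (G k) i \<cdot> snd P k"
      using Comp_Add_left[OF b(3) ap cq] Comp_assoc[OF b(3,1) a] Comp_assoc[OF b(3,2) c]
        id Comp_Idt_right[OF a] Comp_Zero_right[OF c obP] Add_Zero_right[OF a] by (simp add: g_def)
    show "g k \<cdot> j = FArr (G k) j \<cdot> snd Q k"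
      using Comp_Add_left[OF b(4) ap cq] Comp_assoc[OF b(4,1) a] Comp_assoc[OF b(4,2) c]
        id Comp_Idt_right[OF c] Comp_Zero_right[OF a obQ] Add_Zero_left[OF c] by (simp add: g_def)
    note px = Comp_closed[OF b(1) x] and qy = Comp_closed[OF b(2) y]
    \<comment> \<open>Reassociated so that G_k(p) and G_k(q) meet G_k(i) and G_k(j) directly;
      functoriality and additivity turn these composites into identities and zeros, leaving one
      summand.\<close>
    have g': "g k = Add A (FArr (G k) i \<cdot> (snd P k \<cdot> p)) (FArr (G k) j \<cdot> (snd Q k \<cdot> q))"
      using Comp_assoc[OF b(1) x Gi] Comp_assoc[OF b(2) y Gj] by (simp add: g_def)
    note Gx = Comp_closed[OF px Gi] and Gy = Comp_closed[OF qy Gj]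
    show "snd P k \<cdot> p = FArr (G k) p \<cdot> g k"
      using Comp_Add_right[OF Gx Gy Gp] Comp_assoc[OF px Gi Gp] Comp_assoc[OF qy Gj Gp]
        G_Comp[OF k b(3,1)] G_Comp[OF k b(4,1)] id G_Idt[OF k obP] G_Zero[OF k obQ obP]
        Comp_Idt_left[OF px] Comp_Zero_left[OF qy GP] Add_Zero_right[OF px] by (simp add: g')
    show "snd Q k \<cdot> q = FArr (G k) q \<cdot> g k"
      using Comp_Add_right[OF Gx Gy Gq] Comp_assoc[OF px Gi Gq] Comp_assoc[OF qy Gj Gq]
        G_Comp[OF k b(3,2)] G_Comp[OF k b(4,2)] id G_Idt[OF k obQ] G_Zero[OF k obP obQ]
        Comp_Idt_left[OF qy] Comp_Zero_left[OF px GQ] Add_Zero_left[OF qy] by (simp add: g')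
  qed
  then have comp: "compatible (snd P) i g" "compatible (snd Q) j g"
      "compatible g p (snd P)" "compatible g q (snd Q)"
    by (simp_all add: compatible_def)
  let ?S = "(S, restrict g {1..n})"
  have obS: "?S \<in> Obj E"
  proof (rule Obj_E_I[OF fam(1)])
    fix k l
    assume k: "k \<in> {1..n}" and l: "l \<in> {1..n}"
    have "FArr (G k) (snd P l) \<cdot> snd P k = comult k l (fst P) (snd P)"
      "FArr (G k) (snd Q l) \<cdot> snd Q k = comult k l (fst Q) (snd Q)"
      using P Q k l by (simp_all add: Obj_E_iff)
    then have "(FArr (G k) (g l) \<cdot> g k) \<cdot> i = comult k l S g \<cdot> i"
      "(FArr (G k) (g l) \<cdot> g k) \<cdot> j = comult k l S g \<cdot> j"
      using iterate_natural[OF fam(2,1) b(3) comp(1) k l] comult_natural[OF fam(2,1) b(3) comp(1) k l]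
        iterate_natural[OF fam(3,1) b(4) comp(2) k l] comult_natural[OF fam(3,1) b(4) comp(2) k l]
      by simp_all
    then show "FArr (G k) (g l) \<cdot> g k = comult k l S g"
      using biproduct_jointly_epi[OF bp iterate_Hom[OF fam(1) k l] comult_Hom[OF fam(1) k l]] by blast
  qed
  have "mor ?S p P" "mor ?S q Q" "mor P i ?S" "mor Q j ?S"
    using mor_restrict_source[OF obS P b(1) comp(3)] mor_restrict_source[OF obS Q b(2) comp(4)]
      mor_restrict_target[OF obS P b(3) comp(1)] mor_restrict_target[OF obS Q b(4) comp(2)] .
  then have "is_biproduct E P Q ?S (?S, p, P) (?S, q, Q) (P, i, ?S) (Q, j, ?S)"
    using id by (simp add: is_biproduct_def Hom_E)
  then show ?thesis
    by blast
qed

lemma abelian_category_E: "abelian_category E"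
proof
  show "\<exists>P. zero_object E P"
    by (rule E_has_zero_object)
  show "\<exists>S p q i j. is_biproduct E P Q S p q i j" if "P \<in> Obj E" "Q \<in> Obj E" for P Q
    using E_has_biproducts[OF that] .
next
  fix h
  assume "h \<in> Arr E"
  then obtain P f Q where h: "h = (P, f, Q)" and f: "mor P f Q"
    using Arr_E by blast
  have arr: "f \<in> Arr A"
    using mor_Hom[OF f] by (simp add: Hom_def)
  obtain k where ker: "is_kernel A k f"
    using has_kernels[OF arr] by blast
  show "\<exists>k. is_kernel E k h"
    using kernel_lift[OF ker f] E_kernel[OF ker f] h by metis
  obtain c where coker: "is_cokernel A c f"
    using has_cokernels[OF arr] by blast
  show "\<exists>c. is_cokernel E c h"
    using cokernel_descend[OF coker f] E_cokernel[OF coker f] h by metis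
next
  fix h
  assume mono: "monomorphism E h"
  then obtain P f Q where h: "h = (P, f, Q)" and f: "mor P f Q"
    using Arr_E unfolding monomorphism_def by blast
  obtain c where coker: "is_cokernel A c f"
    using has_cokernels mor_Hom[OF f] by (auto simp: Hom_def)
  obtain R where c: "mor Q c R"
    using cokernel_descend[OF coker f] .
  have "is_kernel A f c"
    using mono_is_kernel_of_cokernel[OF mor_Hom[OF f] E_mono_imp_mono[OF f] coker] mono h by simp
  \<comment> \<open>The family on \<open>P\<close> need not be compared with one produced by
    lifting: \<open>E_kernel\<close> accepts any arrow of the extension whose underlying arrow is a
    kernel in \<open>A\<close>.\<close>
  then show "\<exists>f. is_kernel E h f"
    using E_kernel[OF _ c f] h by blast
next
  fix h
  assume epi: "epimorphism E h"
  then obtain P f Q where h: "h = (P, f, Q)" and f: "mor P f Q"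
    using Arr_E unfolding epimorphism_def by blast
  obtain k where ker: "is_kernel A k f"
    using has_kernels mor_Hom[OF f] by (auto simp: Hom_def)
  obtain R where k: "mor R k P"
    using kernel_lift[OF ker f] .
  have "is_cokernel A f k"
    using epi_is_cokernel_of_kernel[OF mor_Hom[OF f] E_epi_imp_epi[OF f] ker] epi h by simp
  then show "\<exists>f. is_cokernel E h f"
    using E_cokernel[OF _ k f] h by blast
qed

end

theorem proposition2p3:
  fixes A :: "('o, 'm) preadditive_cat"
    and n :: nat
    and G :: "nat \<Rightarrow> ('o, 'm, 'o, 'm) func"
    and \<Psi> :: "nat \<Rightarrow> nat \<Rightarrow> 'o \<Rightarrow> 'm"
  assumes "abelian_category A"
    and "n \<ge> 1"
    and "\<forall>i \<in> {1..n}. additive_functor A A (G i)"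
    and "natural_family A n G \<Psi>"
    and "coassociative A n G \<Psi>"
    and "\<forall>i \<in> {1..n}. left_exact A A (G i)"
  shows "abelian_category (left_trivial_extension A n G \<Psi>)"
proof -
  interpret left_extension A n G \<Psi>
    using assms by (auto simp: left_extension_def left_extension_axioms_def)
  show ?thesis
    by (rule abelian_category_E)
qed

end
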